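(* Let $P=(P(i,j))_{(i,j)\in\mathbb{N}^2}$ be an irreducible and aperiodic Markov kernel on $\mathbb{N}$ with a unique invariant probability measure $\pi=(\pi(i))_{i\in\mathbb{N}}$, and assume that there exist $i_0\in\mathbb{N}$ and an integer $N\ge 1$ such that for all $i\ge i_0$ and all $j\in\mathbb{N}$, $|i-j|>N$ implies $P(i,j)=0$. Assume that $P$ is reversible, i.e. $\pi(i)P(i,j)=\pi(j)P(j,i)$ for all $(i,j)\in\mathbb{N}^2$. Set $$\alpha_0:=\sum_{m=-N}^N\limsup_{i\to+\infty}\sqrt{P(i,i+m)\,P(i+m,i)} .$$ Consider the conditions: (L) for every $m=-N,\dots,N$, $P(i,i+m)\to a_m\in[0,1]$ as $i\to+\infty$; (T) $\pi(i+1)/\pi(i)\to\tau\in[0,1)$ as $i\to+\infty$. Then: 1. If $\alpha_0<1$, then $P$ satisfies the spectral gap property on $\ell^2(\pi)$ and $r_{ess}(P_{|\ell^2(\pi)})\le\alpha_0$. 2. If (L) holds, then $$\alpha_0=1-\sum_{m=1}^N\big(\sqrt{a_m}-\sqrt{a_{-m}}\big)^2 .$$ Consequently, if $a_m\ne a_{-m}$ for at least one $m\in\{1,\dots,N\}$, then $\alpha_0<1$. 3. If (L) holds and (T) holds with $\tau\in(0,1)$, then, for $1\le|m|\le N$, $a_m\ne a_{-m}$ provided that $a_m\ne0$. Consequently, if $a_m\ne0$ for some $m$ with $|m|\in\{1,\dots,N\}$, then the conclusions (C) below hold, with $\alpha_0$ given by the formula in 2. 4. If (L) holds with $a_0<1$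 and (T) holds with $\tau=0$, then the conclusions (C) below hold, with $\alpha_0=a_0$. Conclusions (C), where $V:=(\pi(n)^{-1/2})_{n\in\mathbb{N}}$: $\alpha_0<1$; $P$ satisfies both the spectral gap property on $\ell^2(\pi)$ and the spectral gap property on $\mathcal{B}_V$; $\max(r_{ess}(P_{|\mathcal{B}_V}),r_{ess}(P_{|\ell^2(\pi)}))\le\alpha_0$; (a) if $\varrho_V\le\alpha_0$ then $\varrho_2\le\alpha_0$; (b) if $\varrho_V>\alpha_0$ then $\varrho_2=\varrho_V$.
   Context: $\mathbb{N}=\{0,1,2,\dots\}$. By irreducibility $\pi(i)>0$ for all $i$. $\ell^2(\pi)$ is the Hilbert space of sequences $f\in\mathbb{C}^{\mathbb{N}}$ with $\|f\|_2:=[\sum_{i\ge0}|f(i)|^2\pi(i)]^{1/2}<\infty$. $P$ acts by $(Pf)(i)=\sum_jP(i,j)f(j)$. Put $\pi(f):=\sum_{i\ge0}f(i)\pi(i)$ and $\Pi f:=\pi(f)1_{\mathbb{N}}$, with $1_{\mathbb{N}}$ the constant sequence $1$. $\mathcal{B}_V$ is the Banach space of sequences $g\in\mathbb{C}^{\mathbb{N}}$ with $\|g\|_V:=\sup_{n}V(n)^{-1}|g(n)|<\infty$. Spectral gap property on $\ell^2(\pi)$ at rate $\rho\in(0,1)$: there is $C\in(0,+\infty)$ with $\|P^nf-\Pi f\|_2\le C\rho^n\|f\|_2$ for all $n\ge1$, $f\in\ell^2(\pi)$. Spectral gap property on $\mathcal{B}_V$ at rate $\rho\in(0,1)$: there is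 $C\in(0,+\infty)$ with $\|P^nf-\Pi f\|_V\le C\rho^n\|f\|_V$ for all $n\ge1$, $f\in\mathcal{B}_V$. Each property is said to hold if it holds at some rate $\rho\in(0,1)$; $\varrho_2$ and $\varrho_V$ are the infima of the $\rho\in(0,1)$ for which the property holds at rate $\rho$ on $\ell^2(\pi)$ and on $\mathcal{B}_V$ respectively. For a bounded linear operator $T$ on a Banach space, $r_{ess}(T)$ denotes its essential spectral radius, i.e. $r_{ess}(T)=\lim_n(\inf\{\|T^n-K\|:K\text{ compact}\})^{1/n}$; $P_{|\ell^2(\pi)}$ and $P_{|\mathcal{B}_V}$ denote $P$ acting on the indicated space. *)

theory Defs
  imports "HOL-Probability.Probability"
begin

section \<open>Markov kernels on the natural numbers\<close>

text \<open>The entry \<open>P(i,j)\<close> of a Markov kernel is \<^term>\<open>pmf (P i) j\<close>.\<close>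

definition kernel_pow :: "(nat \<Rightarrow> nat pmf) \<Rightarrow> nat \<Rightarrow> nat \<Rightarrow> nat pmf" where
  "kernel_pow P n i = ((\<lambda>\<mu>. bind_pmf \<mu> P) ^^ n) (return_pmf i)"

definition irreducible_kernel :: "(nat \<Rightarrow> nat pmf) \<Rightarrow> bool" where
  "irreducible_kernel P \<longleftrightarrow> (\<forall>i j. \<exists>n. pmf (kernel_pow P n i) j > 0)"

definition aperiodic_kernel :: "(nat \<Rightarrow> nat pmf) \<Rightarrow> bool" where
  "aperiodic_kernel P \<longleftrightarrow> (\<forall>i. Gcd {n. n \<ge> 1 \<and> pmf (kernel_pow P n i) i > 0} = 1)"

definition invariant_pmf :: "(nat \<Rightarrow> nat pmf) \<Rightarrow> nat pmf \<Rightarrow> bool" where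
  "invariant_pmf P \<mu> \<longleftrightarrow> bind_pmf \<mu> P = \<mu>"

definition reversible_kernel :: "(nat \<Rightarrow> nat pmf) \<Rightarrow> nat pmf \<Rightarrow> bool" where
  "reversible_kernel P \<pi> \<longleftrightarrow>
     (\<forall>i j. pmf \<pi> i * pmf (P i) j = pmf \<pi> j * pmf (P j) i)"

definition kernel_op :: "(nat \<Rightarrow> nat pmf) \<Rightarrow> (nat \<Rightarrow> complex) \<Rightarrow> (nat \<Rightarrow> complex)" where
  "kernel_op P f = (\<lambda>i. \<Sum>j. complex_of_real (pmf (P i) j) * f j)"

definition mean :: "nat pmf \<Rightarrow> (nat \<Rightarrow> complex) \<Rightarrow> complex" where
  "mean \<pi> f = (\<Sum>i. f i * complex_of_real (pmf \<pi> i))"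


section \<open>The sequence spaces\<close>

definition l2_space :: "nat pmf \<Rightarrow> (nat \<Rightarrow> complex) set" where
  "l2_space \<pi> = {f. summable (\<lambda>i. (cmod (f i))\<^sup>2 * pmf \<pi> i)}"

definition l2_norm :: "nat pmf \<Rightarrow> (nat \<Rightarrow> complex) \<Rightarrow> real" where
  "l2_norm \<pi> f = sqrt (\<Sum>i. (cmod (f i))\<^sup>2 * pmf \<pi> i)"

definition BV_space :: "(nat \<Rightarrow> real) \<Rightarrow> (nat \<Rightarrow> complex) set" where
  "BV_space V = {g. bdd_above (range (\<lambda>n. cmod (g n) / V n))}"

definition BV_norm :: "(nat \<Rightarrow> real) \<Rightarrow> (nat \<Rightarrow> complex) \<Rightarrow> real" where
  "BV_norm V g = (SUP n. cmod (g n) / V n)"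

definition weight :: "nat pmf \<Rightarrow> nat \<Rightarrow> real" where
  "weight \<pi> n = pmf \<pi> n powr (- 1 / 2)"


section \<open>Operators on a normed space of sequences\<close>

text \<open>
  The spaces depend on \<open>\<pi>\<close>, so a normed space is given by a carrier \<open>X\<close> of complex
  sequences and a norm \<open>nrm\<close> that is meaningful on \<open>X\<close> only; hence the explicit
  membership conditions below.
\<close>

definition linear_op ::
    "(nat \<Rightarrow> complex) set \<Rightarrow> ((nat \<Rightarrow> complex) \<Rightarrow> (nat \<Rightarrow> complex)) \<Rightarrow> bool" where
  "linear_op X T \<longleftrightarrow>
     (\<forall>f\<in>X. T f \<in> X) \<and>
     (\<forall>f\<in>X. \<forall>g\<in>X. T (\<lambda>i. f i + g i) = (\<lambda>i. T f i + T g i)) \<and>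
     (\<forall>c. \<forall>f\<in>X. T (\<lambda>i. c * f i) = (\<lambda>i. c * T f i))"

definition bounded_op ::
    "(nat \<Rightarrow> complex) set \<Rightarrow> ((nat \<Rightarrow> complex) \<Rightarrow> real) \<Rightarrow>
     ((nat \<Rightarrow> complex) \<Rightarrow> (nat \<Rightarrow> complex)) \<Rightarrow> bool" where
  "bounded_op X nrm T \<longleftrightarrow> linear_op X T \<and> (\<exists>B. \<forall>f\<in>X. nrm (T f) \<le> B * nrm f)"

definition compact_op ::
    "(nat \<Rightarrow> complex) set \<Rightarrow> ((nat \<Rightarrow> complex) \<Rightarrow> real) \<Rightarrow>
     ((nat \<Rightarrow> complex) \<Rightarrow> (nat \<Rightarrow> complex)) \<Rightarrow> bool" where
  "compact_op X nrm K \<longleftrightarrow>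
     linear_op X K \<and>
     (\<forall>f :: nat \<Rightarrow> nat \<Rightarrow> complex.
        (\<forall>n. f n \<in> X) \<and> (\<exists>B. \<forall>n. nrm (f n) \<le> B) \<longrightarrow>
        (\<exists>r :: nat \<Rightarrow> nat. \<exists>h\<in>X. strict_mono r \<and>
           (\<lambda>n. nrm (\<lambda>i. K (f (r n)) i - h i)) \<longlonglongrightarrow> 0))"

definition op_norm ::
    "(nat \<Rightarrow> complex) set \<Rightarrow> ((nat \<Rightarrow> complex) \<Rightarrow> real) \<Rightarrow>
     ((nat \<Rightarrow> complex) \<Rightarrow> (nat \<Rightarrow> complex)) \<Rightarrow> real" where
  "op_norm X nrm T = Sup {nrm (T f) | f. f \<in> X \<and> nrm f \<le> 1}"

text \<open>The limit exists for every \<open>T\<close> satisfying \<^const>\<open>bounded_op\<close>; only then is the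
  value meaningful.\<close>

definition ess_spectral_radius ::
    "(nat \<Rightarrow> complex) set \<Rightarrow> ((nat \<Rightarrow> complex) \<Rightarrow> real) \<Rightarrow>
     ((nat \<Rightarrow> complex) \<Rightarrow> (nat \<Rightarrow> complex)) \<Rightarrow> real" where
  "ess_spectral_radius X nrm T =
     lim (\<lambda>n. root n (Inf {op_norm X nrm (\<lambda>f i. (T ^^ n) f i - K f i) | K. compact_op X nrm K}))"


section \<open>The spectral gap property\<close>

definition spectral_gap_at ::
    "(nat \<Rightarrow> complex) set \<Rightarrow> ((nat \<Rightarrow> complex) \<Rightarrow> real) \<Rightarrow>
     (nat \<Rightarrow> nat pmf) \<Rightarrow> nat pmf \<Rightarrow> real \<Rightarrow> bool" where
  "spectral_gap_at X nrm P \<pi> \<rho> \<longleftrightarrow>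
     (\<exists>C>0. \<forall>n\<ge>1. \<forall>f\<in>X.
        (\<lambda>i. (kernel_op P ^^ n) f i - mean \<pi> f) \<in> X \<and>
        nrm (\<lambda>i. (kernel_op P ^^ n) f i - mean \<pi> f) \<le> C * \<rho> ^ n * nrm f)"

definition spectral_gap ::
    "(nat \<Rightarrow> complex) set \<Rightarrow> ((nat \<Rightarrow> complex) \<Rightarrow> real) \<Rightarrow>
     (nat \<Rightarrow> nat pmf) \<Rightarrow> nat pmf \<Rightarrow> bool" where
  "spectral_gap X nrm P \<pi> \<longleftrightarrow> (\<exists>\<rho>\<in>{0<..<1}. spectral_gap_at X nrm P \<pi> \<rho>)"

definition gap_rate ::
    "(nat \<Rightarrow> complex) set \<Rightarrow> ((nat \<Rightarrow> complex) \<Rightarrow> real) \<Rightarrow>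
     (nat \<Rightarrow> nat pmf) \<Rightarrow> nat pmf \<Rightarrow> real" where
  "gap_rate X nrm P \<pi> = Inf {\<rho>\<in>{0<..<1}. spectral_gap_at X nrm P \<pi> \<rho>}"

abbreviation spectral_gap_l2 :: "(nat \<Rightarrow> nat pmf) \<Rightarrow> nat pmf \<Rightarrow> bool" where
  "spectral_gap_l2 P \<pi> \<equiv> spectral_gap (l2_space \<pi>) (l2_norm \<pi>) P \<pi>"

abbreviation spectral_gap_V :: "(nat \<Rightarrow> nat pmf) \<Rightarrow> nat pmf \<Rightarrow> bool" where
  "spectral_gap_V P \<pi> \<equiv> spectral_gap (BV_space (weight \<pi>)) (BV_norm (weight \<pi>)) P \<pi>"

abbreviation rate_l2 :: "(nat \<Rightarrow> nat pmf) \<Rightarrow> nat pmf \<Rightarrow> real" where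
  "rate_l2 P \<pi> \<equiv> gap_rate (l2_space \<pi>) (l2_norm \<pi>) P \<pi>"

abbreviation rate_V :: "(nat \<Rightarrow> nat pmf) \<Rightarrow> nat pmf \<Rightarrow> real" where
  "rate_V P \<pi> \<equiv> gap_rate (BV_space (weight \<pi>)) (BV_norm (weight \<pi>)) P \<pi>"

abbreviation bounded_l2 :: "(nat \<Rightarrow> nat pmf) \<Rightarrow> nat pmf \<Rightarrow> bool" where
  "bounded_l2 P \<pi> \<equiv> bounded_op (l2_space \<pi>) (l2_norm \<pi>) (kernel_op P)"

abbreviation bounded_V :: "(nat \<Rightarrow> nat pmf) \<Rightarrow> nat pmf \<Rightarrow> bool" where
  "bounded_V P \<pi> \<equiv> bounded_op (BV_space (weight \<pi>)) (BV_norm (weight \<pi>)) (kernel_op P)"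

abbreviation r_ess_l2 :: "(nat \<Rightarrow> nat pmf) \<Rightarrow> nat pmf \<Rightarrow> real" where
  "r_ess_l2 P \<pi> \<equiv> ess_spectral_radius (l2_space \<pi>) (l2_norm \<pi>) (kernel_op P)"

abbreviation r_ess_V :: "(nat \<Rightarrow> nat pmf) \<Rightarrow> nat pmf \<Rightarrow> real" where
  "r_ess_V P \<pi> \<equiv> ess_spectral_radius (BV_space (weight \<pi>)) (BV_norm (weight \<pi>)) (kernel_op P)"


section \<open>Asymptotics along the diagonals\<close>

text \<open>
  The index \<open>i + m\<close> with \<open>m\<close> a possibly negative integer is \<open>nat (int i + m)\<close>; the
  truncation at \<open>0\<close> affects only finitely many \<open>i\<close>.  The limit superior is taken in
  \<^typ>\<open>ereal\<close>; it is finite because the terms lie in \<open>[0,1]\<close>.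
\<close>

definition alpha0 :: "(nat \<Rightarrow> nat pmf) \<Rightarrow> nat \<Rightarrow> real" where
  "alpha0 P N = (\<Sum>m\<in>{- int N..int N}. real_of_ereal (limsup (\<lambda>i.
     ereal (sqrt (pmf (P i) (nat (int i + m)) * pmf (P (nat (int i + m))) i)))))"

definition diagonal_limits :: "(nat \<Rightarrow> nat pmf) \<Rightarrow> nat \<Rightarrow> (int \<Rightarrow> real) \<Rightarrow> bool" where
  "diagonal_limits P N a \<longleftrightarrow>
     (\<forall>m\<in>{- int N..int N}. a m \<in> {0..1} \<and> (\<lambda>i. pmf (P i) (nat (int i + m))) \<longlonglongrightarrow> a m)"

definition tail_ratio :: "nat pmf \<Rightarrow> real \<Rightarrow> bool" where
  "tail_ratio \<pi> \<tau> \<longleftrightarrow> \<tau> \<in> {0..<1} \<and> (\<lambda>i. pmf \<pi> (i + 1) / pmf \<pi> i) \<longlonglongrightarrow> \<tau>"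

definition gap_conclusions :: "(nat \<Rightarrow> nat pmf) \<Rightarrow> nat pmf \<Rightarrow> nat \<Rightarrow> bool" where
  "gap_conclusions P \<pi> N \<longleftrightarrow>
     alpha0 P N < 1 \<and>
     spectral_gap_l2 P \<pi> \<and> spectral_gap_V P \<pi> \<and>
     bounded_l2 P \<pi> \<and> bounded_V P \<pi> \<and>
     max (r_ess_V P \<pi>) (r_ess_l2 P \<pi>) \<le> alpha0 P N \<and>
     (rate_V P \<pi> \<le> alpha0 P N \<longrightarrow> rate_l2 P \<pi> \<le> alpha0 P N) \<and>
     (rate_V P \<pi> > alpha0 P N \<longrightarrow> rate_l2 P \<pi> = rate_V P \<pi>)"

end

theory Submission imports Defs begin

text \<open>
  Multiplication by \<open>sqrt \<pi>\<close> maps \<open>\<ell>\<^sup>2(\<pi>)\<close> onto \<open>\<ell>\<^sup>2\<close> and, since \<open>V(n) = 1 / sqrt (\<pi>(n))\<close>,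
  maps \<open>B\<^sub>V\<close> onto \<open>\<ell>\<^sup>\<infinity>\<close>.  Under this map \<open>P\<close> becomes the matrix with entries
  \<open>s i j = sqrt (P(i,j) P(j,i))\<close>.  By reversibility this matrix is symmetric and banded, and
  \<open>\<alpha>\<^sub>0\<close> dominates the sums of its far rows: for every \<open>r > \<alpha>\<^sub>0\<close> there is a row from which on all
  row sums are at most \<open>r\<close>.

  Fix such an \<open>r\<close>, and split \<open>P = T + H\<close>, where \<open>T\<close> keeps the rows from \<open>K\<close> on and \<open>H\<close> the rows
  below \<open>K\<close>.  For large \<open>K\<close> the column sums of \<open>T\<close> are bounded by \<open>r\<close> as well, so Schur's test
  gives norm at most \<open>r\<close> for \<open>T\<close> on both spaces, while \<open>H\<close> has finite rank.  Modulo compact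
  operators \<open>P ^ n\<close> then has norm at most \<open>r ^ n\<close>, which bounds both essential spectral radii
  by \<open>r\<close>.

  The gap on \<open>\<ell>\<^sup>2(\<pi>)\<close> comes from a direct estimate instead of spectral theory.  The difference
  \<open>\<parallel>f\<parallel>\<^sup>2 - \<parallel>P f\<parallel>\<^sup>2\<close> is the \<open>\<pi>\<close>-average of the variances of \<open>f\<close> under the rows of \<open>P\<close>, hence it
  controls \<open>\<bar>f a - f b\<bar>\<^sup>2\<close> whenever one row charges both \<open>a\<close> and \<open>b\<close>.  Reversibility,
  irreducibility and aperiodicity connect any two states by finitely many such pairs.  So a function
  of mean zero with a small defect is almost constant on a large finite set, and therefore small there.
  For such a function \<open>H f\<close> is negligible, and \<open>\<parallel>P f\<parallel>\<close> is at most about \<open>r \<parallel>f\<parallel>\<close> with \<open>r < 1\<close>,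
  so the defect is not small after all.  This is \<open>l2_strict_contraction\<close>.

  The two gaps are compared through \<open>E\<^sub>n = P ^ n - \<Pi>\<close>, which satisfies both
  \<open>E\<^sub>n\<^sub>+\<^sub>1 = T E\<^sub>n + H E\<^sub>n\<close> and \<open>E\<^sub>n\<^sub>+\<^sub>1 = E\<^sub>n T + E\<^sub>n H\<close>.  Since \<open>\<ell>\<^sup>2(\<pi>) \<subseteq> B\<^sub>V\<close> and \<open>H\<close> maps \<open>B\<^sub>V\<close>
  boundedly into \<open>\<ell>\<^sup>2(\<pi>)\<close>, the first recursion carries a gap at rate \<open>\<rho> > r\<close> from \<open>B\<^sub>V\<close> to
  \<open>\<ell>\<^sup>2(\<pi>)\<close> and the second one carries it back.  The admissible rates above \<open>\<alpha>\<^sub>0\<close> are thus the same on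
  both spaces, which is the content of (a) and (b).

  The formulas for \<open>\<alpha>\<^sub>0\<close> follow by passing to the limit in \<open>\<Sum>\<^sub>m P(i,i+m) = 1\<close> and in
  \<open>\<pi>(i) P(i,i+m) = \<pi>(i+m) P(i+m,i)\<close>, the latter giving \<open>a\<^sub>m = \<tau> ^ m a\<^sub>-\<^sub>m\<close> for \<open>m \<ge> 1\<close>.
\<close>

section \<open>Compact operators and the essential spectral radius\<close>

text \<open>
  Fekete's lemma in multiplicative form; it provides the limit in the definition of the essential
  spectral radius.  The limit is the infimum \<open>l\<close> of the roots: if \<open>root m (a m) < x\<close>, division of
  \<open>n\<close> by \<open>m\<close> with remainder gives \<open>a n \<le> C * x ^ n\<close> with \<open>C\<close> independent of \<open>n\<close>.
\<close>

lemma submultiplicative_root_convergent: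
  fixes a :: "nat \<Rightarrow> real"
  assumes nonneg: "\<And>n. a n \<ge> 0" and sub: "\<And>m n. a (m + n) \<le> a m * a n"
  shows "convergent (\<lambda>n. root n (a n))"
proof -
  define l where "l = (INF n\<in>{1..}. root n (a n))"
  have bdd: "bdd_below ((\<lambda>n. root n (a n)) ` {1..})"
    by (intro bdd_belowI[where m = 0]) (auto intro: real_root_ge_zero nonneg)
  have l_le: "l \<le> root n (a n)" if "n \<ge> 1" for n
    unfolding l_def using that by (intro cINF_lower bdd) auto
  have l_nonneg: "l \<ge> 0"
    unfolding l_def by (intro cINF_greatest) (auto intro: real_root_ge_zero nonneg)
  have upper: "eventually (\<lambda>n. root n (a n) < y) sequentially" if "y > l" for y
  proof -
    define x where "x = (l + y) / 2"
    have x: "l < x" "x < y" "x > 0" using that l_nonneg by (auto simp: x_def)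
    obtain m where m: "m \<ge> 1" "root m (a m) < x"
      using x(1) unfolding l_def by (subst (asm) cINF_less_iff[OF _ bdd]) auto
    have am: "a m \<le> x ^ m"
    proof -
      have "a m = root m (a m) ^ m" using m nonneg by simp
      also have "\<dots> \<le> x ^ m" using m nonneg by (intro power_mono) (auto intro: real_root_ge_zero)
      finally show ?thesis .
    qed
    have power: "a (q * m + t) \<le> (x ^ m) ^ q * a t" for q t
    proof (induction q)
      case (Suc q)
      have "a (Suc q * m + t) = a (m + (q * m + t))" by (simp add: algebra_simps)
      also have "\<dots> \<le> a m * a (q * m + t)" by (rule sub)
      also have "\<dots> \<le> x ^ m * ((x ^ m) ^ q * a t)"
        using Suc am x nonneg by (intro mult_mono) auto
      finally show ?case by (simp add: mult_ac)
    qed auto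
    define C where "C = 1 + (\<Sum>t<m. a t / x ^ t)"
    have C: "C > 0" unfolding C_def using x nonneg by (intro add_pos_nonneg sum_nonneg) auto
    have bound: "a n \<le> C * x ^ n" for n
    proof -
      define t where "t = n mod m"
      have t: "t < m" "n = (n div m) * m + t" using m by (auto simp: t_def)
      have "a n \<le> (x ^ m) ^ (n div m) * a t" using power[of "n div m" t] t by simp
      also have "(x ^ m) ^ (n div m) = x ^ n / x ^ t"
        using t x by (metis nonzero_mult_div_cancel_right order_less_irrefl power_add power_mult
            power_not_zero mult.commute)
      also have "x ^ n / x ^ t * a t = x ^ n * (a t / x ^ t)" by simp
      also have "a t / x ^ t \<le> (\<Sum>t<m. a t / x ^ t)"
        using t x nonneg by (intro member_le_sum) auto
      also have "\<dots> \<le> C" by (simp add: C_def)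
      finally show ?thesis using x by (simp add: mult.commute)
    qed
    have "(\<lambda>n. root n C * x) \<longlonglongrightarrow> 1 * x"
      by (intro tendsto_intros LIMSEQ_root_const C)
    then have "eventually (\<lambda>n. root n C * x < y) sequentially"
      using x by (intro order_tendstoD) auto
    then show ?thesis using eventually_ge_at_top[of 1]
    proof eventually_elim
      case (elim n)
      have "root n (a n) \<le> root n (C * x ^ n)"
        using elim bound by (intro real_root_le_mono) auto
      also have "\<dots> = root n C * x"
        using elim x by (simp add: real_root_mult real_root_power_cancel)
      finally show ?case using elim by simp
    qed
  qed
  have "(\<lambda>n. root n (a n)) \<longlonglongrightarrow> l"
  proof (rule order_tendstoI)
    fix y assume "y < l"
    then show "eventually (\<lambda>n. y < root n (a n)) sequentially"
      using l_le by (intro eventually_mono[OF eventually_ge_at_top[of 1]]) (auto intro: less_le_trans)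
  qed (rule upper)
  then show ?thesis by (rule convergentI)
qed

text \<open>
  The common features of \<open>\<ell>\<^sup>2(\<pi>)\<close> and \<open>B\<^sub>V\<close>, both with \<open>w = sqrt \<pi>\<close>: in the weighted coordinates
  \<open>f i * w i\<close> the norm lies between the supremum norm and, on finitely supported sequences, the
  norm of \<open>\<ell>\<^sup>1\<close>.
\<close>

locale sequence_space =
  fixes X :: "(nat \<Rightarrow> complex) set" and nrm :: "(nat \<Rightarrow> complex) \<Rightarrow> real" and w :: "nat \<Rightarrow> real"
  assumes w_pos: "w i > 0"
    and add_mem: "f \<in> X \<Longrightarrow> g \<in> X \<Longrightarrow> (\<lambda>i. f i + g i) \<in> X"
    and nrm_add: "f \<in> X \<Longrightarrow> g \<in> X \<Longrightarrow> nrm (\<lambda>i. f i + g i) \<le> nrm f + nrm g"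
    and scale_mem: "f \<in> X \<Longrightarrow> (\<lambda>i. c * f i) \<in> X"
    and nrm_scale: "f \<in> X \<Longrightarrow> nrm (\<lambda>i. c * f i) = cmod c * nrm f"
    and coord_le: "f \<in> X \<Longrightarrow> cmod (f i) * w i \<le> nrm f"
    and fin_supp_mem: "(\<And>i. i \<ge> K \<Longrightarrow> f i = 0) \<Longrightarrow> f \<in> X"
    and fin_supp_nrm: "(\<And>i. i \<ge> K \<Longrightarrow> f i = 0) \<Longrightarrow> nrm f \<le> (\<Sum>i<K. cmod (f i) * w i)"
begin

lemma nrm_nonneg: "f \<in> X \<Longrightarrow> nrm f \<ge> 0"
  using coord_le[of f 0] w_pos[of 0] by (smt (verit) mult_nonneg_nonneg norm_ge_zero)

lemma nrm_zero_iff: "f \<in> X \<Longrightarrow> nrm f = 0 \<longleftrightarrow> f = (\<lambda>i. 0)"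
proof
  assume f: "f \<in> X" "nrm f = 0"
  have "f i = 0" for i
  proof -
    have "cmod (f i) * w i \<le> 0" using coord_le[OF f(1), of i] f(2) by simp
    then show ?thesis using w_pos[of i] by (simp add: mult_le_0_iff)
  qed
  then show "f = (\<lambda>i. 0)" by auto
next
  assume "f \<in> X" "f = (\<lambda>i. 0)"
  then show "nrm f = 0" using nrm_scale[of f 0] by simp
qed

lemma zero_mem: "(\<lambda>i. 0) \<in> X"
  by (rule fin_supp_mem) auto

lemma diff_mem: "f \<in> X \<Longrightarrow> g \<in> X \<Longrightarrow> (\<lambda>i. f i - g i) \<in> X"
  using add_mem[of f "\<lambda>i. (-1) * g i"] scale_mem[of g "-1"] by simp

lemma nrm_diff: "f \<in> X \<Longrightarrow> g \<in> X \<Longrightarrow> nrm (\<lambda>i. f i - g i) \<le> nrm f + nrm g"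
  using nrm_add[of f "\<lambda>i. (-1) * g i"] nrm_scale[of g "-1"] scale_mem[of g "-1"] by simp

lemma linear_opD:
  assumes "linear_op X T"
  shows "f \<in> X \<Longrightarrow> T f \<in> X"
    and "f \<in> X \<Longrightarrow> g \<in> X \<Longrightarrow> T (\<lambda>i. f i + g i) = (\<lambda>i. T f i + T g i)"
    and "f \<in> X \<Longrightarrow> T (\<lambda>i. c * f i) = (\<lambda>i. c * T f i)"
  using assms by (auto simp: linear_op_def)

lemma linear_op_diffD:
  assumes "linear_op X T" "f \<in> X" "g \<in> X"
  shows "T (\<lambda>i. f i - g i) = (\<lambda>i. T f i - T g i)"
  using linear_opD(2)[OF assms(1,2) scale_mem[OF assms(3), of "-1"]]
    linear_opD(3)[OF assms(1,3), of "-1"] by simp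

lemma linear_op_add:
  assumes "linear_op X S" "linear_op X T"
  shows "linear_op X (\<lambda>f i. S f i + T f i)"
  unfolding linear_op_def
  using assms[THEN linear_opD(1)] assms[THEN linear_opD(2)] assms[THEN linear_opD(3)]
  by (auto intro!: add_mem simp: algebra_simps)

lemma linear_op_diff:
  assumes "linear_op X S" "linear_op X T"
  shows "linear_op X (\<lambda>f i. S f i - T f i)"
  unfolding linear_op_def
  using assms[THEN linear_opD(1)] assms[THEN linear_opD(2)] assms[THEN linear_opD(3)]
  by (auto intro!: diff_mem simp: algebra_simps)

lemma linear_op_compose:
  assumes "linear_op X S" "linear_op X T"
  shows "linear_op X (\<lambda>f. S (T f))"
  unfolding linear_op_def
  using assms[THEN linear_opD(1)] assms[THEN linear_opD(2)] assms[THEN linear_opD(3)]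
  by auto

lemma linear_op_zero: "linear_op X (\<lambda>f i. 0)"
  by (auto simp: linear_op_def zero_mem)

lemma bounded_op_obtain:
  assumes "bounded_op X nrm T"
  obtains B where "B > 0" "\<And>f. f \<in> X \<Longrightarrow> nrm (T f) \<le> B * nrm f"
proof -
  obtain B where B: "\<And>f. f \<in> X \<Longrightarrow> nrm (T f) \<le> B * nrm f"
    using assms by (auto simp: bounded_op_def)
  have "nrm (T f) \<le> max 1 B * nrm f" if "f \<in> X" for f
    using B[OF that] mult_right_mono[OF max.cobounded2[of B 1] nrm_nonneg[OF that]] by linarith
  then show ?thesis by (intro that[of "max 1 B"]) auto
qed

lemma bounded_op_linear: "bounded_op X nrm T \<Longrightarrow> linear_op X T"
  by (simp add: bounded_op_def)

lemma bounded_op_diff: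
  assumes "bounded_op X nrm S" "bounded_op X nrm T"
  shows "bounded_op X nrm (\<lambda>f i. S f i - T f i)"
proof -
  obtain B where B: "\<And>f. f \<in> X \<Longrightarrow> nrm (S f) \<le> B * nrm f"
    using bounded_op_obtain[OF assms(1)] by blast
  obtain C where C: "\<And>f. f \<in> X \<Longrightarrow> nrm (T f) \<le> C * nrm f"
    using bounded_op_obtain[OF assms(2)] by blast
  have "nrm (\<lambda>i. S f i - T f i) \<le> (B + C) * nrm f" if f: "f \<in> X" for f
    using nrm_diff[of "S f" "T f"] B[OF f] C[OF f] assms[THEN bounded_op_linear, THEN linear_opD(1)] f
    by (fastforce simp: algebra_simps)
  then show ?thesis
    using assms linear_op_diff by (auto simp: bounded_op_def)
qed

lemma bounded_op_compose:
  assumes "bounded_op X nrm S" "bounded_op X nrm T"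
  shows "bounded_op X nrm (\<lambda>f. S (T f))"
proof -
  obtain B where B: "B > 0" "\<And>f. f \<in> X \<Longrightarrow> nrm (S f) \<le> B * nrm f"
    using bounded_op_obtain[OF assms(1)] by blast
  obtain C where C: "\<And>f. f \<in> X \<Longrightarrow> nrm (T f) \<le> C * nrm f"
    using bounded_op_obtain[OF assms(2)] by blast
  have "nrm (S (T f)) \<le> (B * C) * nrm f" if f: "f \<in> X" for f
  proof -
    have "nrm (S (T f)) \<le> B * nrm (T f)"
      using B f assms(2)[THEN bounded_op_linear, THEN linear_opD(1)] by blast
    also have "\<dots> \<le> B * (C * nrm f)" using B C f by (intro mult_left_mono) auto
    finally show ?thesis by simp
  qed
  then show ?thesis
    using assms linear_op_compose by (auto simp: bounded_op_def)
qed

lemma bounded_op_funpow: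
  assumes "bounded_op X nrm T"
  shows "bounded_op X nrm (T ^^ n)"
proof (induction n)
  case 0
  show ?case unfolding bounded_op_def linear_op_def by (auto intro!: exI[of _ 1])
next
  case (Suc n)
  then show ?case using bounded_op_compose[OF assms Suc] by (simp add: o_def)
qed

lemma op_norm_bdd:
  assumes "bounded_op X nrm T"
  shows "bdd_above {nrm (T f) | f. f \<in> X \<and> nrm f \<le> 1}"
proof -
  obtain B where B: "B > 0" "\<And>f. f \<in> X \<Longrightarrow> nrm (T f) \<le> B * nrm f"
    using bounded_op_obtain[OF assms] by blast
  show ?thesis
  proof (rule bdd_aboveI[where M = B], clarify)
    fix f assume f: "f \<in> X" "nrm f \<le> 1"
    then show "nrm (T f) \<le> B" using B(2)[OF f(1)] mult_left_le[OF f(2), of B] B(1) by linarith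
  qed
qed

lemma op_norm_ge:
  assumes "bounded_op X nrm T" "f \<in> X"
  shows "nrm (T f) \<le> op_norm X nrm T * nrm f"
proof (cases "nrm f = 0")
  case True
  then show ?thesis
    using bounded_op_obtain[OF assms(1)] assms(2) by (metis mult_zero_right)
next
  case False
  then have pos: "nrm f > 0" using nrm_nonneg[OF assms(2)] by simp
  define g where "g = (\<lambda>i. complex_of_real (1 / nrm f) * f i)"
  have g: "g \<in> X" "nrm g = 1"
    using pos nrm_scale[OF assms(2), of "complex_of_real (1 / nrm f)"]
      scale_mem[OF assms(2), of "complex_of_real (1 / nrm f)"]
    by (auto simp: g_def norm_divide)
  have "nrm (T g) \<le> op_norm X nrm T"
    unfolding op_norm_def using g by (intro cSup_upper op_norm_bdd assms) auto
  moreover have "T g = (\<lambda>i. complex_of_real (1 / nrm f) * T f i)"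
    unfolding g_def using assms by (intro linear_opD(3)) (auto simp: bounded_op_def)
  then have "nrm (T g) = nrm (T f) / nrm f"
    using pos nrm_scale[of "T f" "complex_of_real (1 / nrm f)"] assms
    by (auto simp: bounded_op_def linear_op_def norm_divide)
  ultimately show ?thesis using pos by (simp add: divide_le_eq)
qed

lemma op_norm_le:
  assumes "\<And>f. f \<in> X \<Longrightarrow> nrm (T f) \<le> B * nrm f" "B \<ge> 0"
  shows "op_norm X nrm T \<le> B"
  unfolding op_norm_def
proof (rule cSup_least)
  have "(\<lambda>i. 0) \<in> X \<and> nrm (\<lambda>i. 0) \<le> 1" using nrm_zero_iff[OF zero_mem] zero_mem by auto
  then show "{nrm (T f) |f. f \<in> X \<and> nrm f \<le> 1} \<noteq> {}" by blast
next
  fix x assume "x \<in> {nrm (T f) |f. f \<in> X \<and> nrm f \<le> 1}"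
  then obtain f where f: "f \<in> X" "nrm f \<le> 1" "x = nrm (T f)" by auto
  then show "x \<le> B" using assms(1)[OF f(1)] mult_left_le[OF f(2) assms(2)] by linarith
qed

lemma op_norm_nonneg:
  assumes "bounded_op X nrm T"
  shows "op_norm X nrm T \<ge> 0"
proof -
  have "nrm (T (\<lambda>i. 0)) \<ge> 0"
    using assms zero_mem by (intro nrm_nonneg) (auto simp: bounded_op_def linear_op_def)
  also have "nrm (T (\<lambda>i. 0)) \<le> op_norm X nrm T"
    unfolding op_norm_def using zero_mem nrm_zero_iff[OF zero_mem]
    by (intro cSup_upper op_norm_bdd assms) auto
  finally show ?thesis .
qed

lemma compact_op_linear: "compact_op X nrm K \<Longrightarrow> linear_op X K"
  by (simp add: compact_op_def)

lemma compact_op_obtain: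
  assumes "compact_op X nrm K" "\<And>n. f n \<in> X" "\<And>n. nrm (f n) \<le> B"
  obtains r h where "strict_mono (r :: nat \<Rightarrow> nat)" "h \<in> X"
    "(\<lambda>n. nrm (\<lambda>i. K (f (r n)) i - h i)) \<longlonglongrightarrow> 0"
  using assms unfolding compact_op_def by blast

lemma compact_opI:
  assumes "linear_op X K"
    and "\<And>f B. (\<And>n. f n \<in> X) \<Longrightarrow> (\<And>n. nrm (f n) \<le> B) \<Longrightarrow>
      \<exists>r :: nat \<Rightarrow> nat. \<exists>h\<in>X. strict_mono r \<and> (\<lambda>n. nrm (\<lambda>i. K (f (r n)) i - h i)) \<longlonglongrightarrow> 0"
  shows "compact_op X nrm K"
  using assms unfolding compact_op_def by blast

text \<open>
  For an unbounded operator there are unit vectors whose images have norm at least \<open>n\<close>, and no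
  subsequence of these images converges.
\<close>

lemma compact_op_bounded:
  assumes "compact_op X nrm K"
  shows "bounded_op X nrm K"
proof (rule ccontr)
  assume "\<not> bounded_op X nrm K"
  then have "\<forall>B. \<exists>f\<in>X. nrm (K f) > B * nrm f"
    using compact_op_linear[OF assms] by (auto simp: bounded_op_def not_le)
  then have "\<forall>n::nat. \<exists>f\<in>X. nrm (K f) > real n * nrm f" by blast
  then obtain g where g: "\<And>n::nat. g n \<in> X" "\<And>n. nrm (K (g n)) > real n * nrm (g n)"
    by metis
  have KX: "K f \<in> X" if "f \<in> X" for f
    using that compact_op_linear[OF assms] by (rule linear_opD(1)[rotated])
  have gpos: "nrm (g n) > 0" for n
  proof -
    have "nrm (g n) \<noteq> 0"
    proof
      assume "nrm (g n) = 0"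
      then have "g n = (\<lambda>i. 0)" using nrm_zero_iff[OF g(1)] by simp
      then have "K (g n) = (\<lambda>i. 0 * K (g n) i)"
        using linear_opD(3)[OF compact_op_linear[OF assms] g(1)[of n], of 0] by simp
      then have "nrm (K (g n)) = 0" using nrm_zero_iff[OF zero_mem] by simp
      then show False using g(2)[of n] \<open>nrm (g n) = 0\<close> by simp
    qed
    then show ?thesis using nrm_nonneg[OF g(1)[of n]] by simp
  qed
  define f where "f = (\<lambda>n i. complex_of_real (1 / nrm (g n)) * g n i)"
  have f: "f n \<in> X" "nrm (f n) \<le> 1" for n
    using gpos[of n] nrm_scale[OF g(1)[of n], of "complex_of_real (1 / nrm (g n))"]
      scale_mem[OF g(1)[of n], of "complex_of_real (1 / nrm (g n))"]
    by (auto simp: f_def norm_divide)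
  have "nrm (K (f n)) = nrm (K (g n)) / nrm (g n)" for n
    using gpos[of n] nrm_scale[OF KX[OF g(1)[of n]], of "complex_of_real (1 / nrm (g n))"]
      linear_opD(3)[OF compact_op_linear[OF assms] g(1)[of n], of "complex_of_real (1 / nrm (g n))"]
    by (simp add: f_def norm_divide)
  then have big: "nrm (K (f n)) > real n" for n
    using g(2)[of n] gpos[of n] by (simp add: less_divide_eq)
  obtain r h where r: "strict_mono (r :: nat \<Rightarrow> nat)" "h \<in> X"
    "(\<lambda>n. nrm (\<lambda>i. K (f (r n)) i - h i)) \<longlonglongrightarrow> 0"
    by (rule compact_op_obtain[OF assms f])
  have "eventually (\<lambda>n. nrm (\<lambda>i. K (f (r n)) i - h i) < 1) sequentially"
    using r(3) by (rule order_tendstoD) simp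
  moreover have "eventually (\<lambda>n. real n > nrm h + 1) sequentially"
    using filterlim_real_sequentially filterlim_at_top_dense by blast
  ultimately have "eventually (\<lambda>n. False) sequentially"
  proof eventually_elim
    case (elim n)
    have "nrm (K (f (r n))) \<le> nrm (\<lambda>i. K (f (r n)) i - h i) + nrm h"
      using nrm_add[OF diff_mem[OF KX[OF f(1)[of "r n"]] r(2)] r(2)] by simp
    moreover have "real n \<le> real (r n)" using r(1) by (simp add: seq_suble)
    ultimately show ?case using big[of "r n"] elim by linarith
  qed
  then show False by simp
qed

lemma compact_op_add:
  assumes "compact_op X nrm J" "compact_op X nrm K"
  shows "compact_op X nrm (\<lambda>f i. J f i + K f i)"
proof (rule compact_opI)
  show "linear_op X (\<lambda>f i. J f i + K f i)"
    using assms by (intro linear_op_add compact_op_linear)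
next
  fix f B assume f: "\<And>n. f n \<in> X" "\<And>n::nat. nrm (f n) \<le> B"
  obtain r h where r: "strict_mono (r :: nat \<Rightarrow> nat)" "h \<in> X"
    "(\<lambda>n. nrm (\<lambda>i. J (f (r n)) i - h i)) \<longlonglongrightarrow> 0"
    by (rule compact_op_obtain[OF assms(1) f])
  obtain q k where q: "strict_mono (q :: nat \<Rightarrow> nat)" "k \<in> X"
    "(\<lambda>n. nrm (\<lambda>i. K (f (r (q n))) i - k i)) \<longlonglongrightarrow> 0"
    by (rule compact_op_obtain[OF assms(2), of "\<lambda>n. f (r n)"]) (use f in auto)
  have JX: "J (f n) \<in> X" and KX: "K (f n) \<in> X" for n
    using linear_opD(1)[OF compact_op_linear[OF assms(1)] f(1)]
      linear_opD(1)[OF compact_op_linear[OF assms(2)] f(1)] by auto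
  have J: "(\<lambda>n. nrm (\<lambda>i. J (f (r (q n))) i - h i)) \<longlonglongrightarrow> 0"
    using LIMSEQ_subseq_LIMSEQ[OF r(3) q(1)] by (simp add: o_def)
  have le: "nrm (\<lambda>i. (J (f (r (q n))) i + K (f (r (q n))) i) - (h i + k i))
    \<le> nrm (\<lambda>i. J (f (r (q n))) i - h i) + nrm (\<lambda>i. K (f (r (q n))) i - k i)" for n
    using nrm_add[OF diff_mem[OF JX r(2)] diff_mem[OF KX q(2)], of "r (q n)" "r (q n)"]
    by (simp add: algebra_simps)
  have "(\<lambda>n. nrm (\<lambda>i. (J (f (r (q n))) i + K (f (r (q n))) i) - (h i + k i))) \<longlonglongrightarrow> 0"
  proof (rule real_tendsto_sandwich[OF _ _ tendsto_const])
    show "(\<lambda>n. nrm (\<lambda>i. J (f (r (q n))) i - h i) + nrm (\<lambda>i. K (f (r (q n))) i - k i)) \<longlonglongrightarrow> 0"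
      using tendsto_add[OF J q(3)] by simp
  qed (intro always_eventually allI nrm_nonneg diff_mem add_mem JX KX r q le)+
  then show "\<exists>s :: nat \<Rightarrow> nat. \<exists>h'\<in>X. strict_mono s \<and>
      (\<lambda>n. nrm (\<lambda>i. (J (f (s n)) i + K (f (s n)) i) - h' i)) \<longlonglongrightarrow> 0"
    using strict_mono_o[OF r(1) q(1)] add_mem[OF r(2) q(2)]
    by (intro exI[of _ "r \<circ> q"] bexI[of _ "\<lambda>i. h i + k i"] conjI) simp_all
qed

lemma compact_op_compose_left:
  assumes "bounded_op X nrm T" "compact_op X nrm K"
  shows "compact_op X nrm (\<lambda>f. T (K f))"
proof (rule compact_opI)
  show "linear_op X (\<lambda>f. T (K f))"
    by (rule linear_op_compose[OF bounded_op_linear[OF assms(1)] compact_op_linear[OF assms(2)]])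
next
  fix f B assume f: "\<And>n. f n \<in> X" "\<And>n::nat. nrm (f n) \<le> B"
  obtain r h where r: "strict_mono (r :: nat \<Rightarrow> nat)" "h \<in> X"
    "(\<lambda>n. nrm (\<lambda>i. K (f (r n)) i - h i)) \<longlonglongrightarrow> 0"
    by (rule compact_op_obtain[OF assms(2) f])
  obtain C where C: "C > 0" "\<And>f. f \<in> X \<Longrightarrow> nrm (T f) \<le> C * nrm f"
    using bounded_op_obtain[OF assms(1)] by blast
  have TX: "T g \<in> X" if "g \<in> X" for g
    using linear_opD(1)[OF bounded_op_linear[OF assms(1)] that] .
  have KX: "K (f n) \<in> X" for n
    using linear_opD(1)[OF compact_op_linear[OF assms(2)] f(1)] .
  have le: "nrm (\<lambda>i. T (K (f (r n))) i - T h i) \<le> C * nrm (\<lambda>i. K (f (r n)) i - h i)" for n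
    using C(2)[OF diff_mem[OF KX r(2)], of "r n"]
      linear_op_diffD[OF bounded_op_linear[OF assms(1)] KX r(2), of "r n"] by simp
  have "(\<lambda>n. nrm (\<lambda>i. T (K (f (r n))) i - T h i)) \<longlonglongrightarrow> 0"
  proof (rule real_tendsto_sandwich[OF _ _ tendsto_const])
    show "(\<lambda>n. C * nrm (\<lambda>i. K (f (r n)) i - h i)) \<longlonglongrightarrow> 0"
      using tendsto_mult_right_zero[OF r(3)] by simp
  qed (intro always_eventually allI nrm_nonneg diff_mem TX KX r le)+
  then show "\<exists>s :: nat \<Rightarrow> nat. \<exists>h'\<in>X. strict_mono s \<and> (\<lambda>n. nrm (\<lambda>i. T (K (f (s n))) i - h' i)) \<longlonglongrightarrow> 0"
    using r TX by (intro exI[of _ r] bexI[of _ "T h"]) auto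
qed

lemma compact_op_compose_right:
  assumes "compact_op X nrm K" "bounded_op X nrm T"
  shows "compact_op X nrm (\<lambda>f. K (T f))"
proof (rule compact_opI)
  show "linear_op X (\<lambda>f. K (T f))"
    by (rule linear_op_compose[OF compact_op_linear[OF assms(1)] bounded_op_linear[OF assms(2)]])
next
  fix f B assume f: "\<And>n. f n \<in> X" "\<And>n::nat. nrm (f n) \<le> B"
  obtain C where C: "C > 0" "\<And>f. f \<in> X \<Longrightarrow> nrm (T f) \<le> C * nrm f"
    using bounded_op_obtain[OF assms(2)] by blast
  have "T (f n) \<in> X" for n
    using linear_opD(1)[OF bounded_op_linear[OF assms(2)] f(1)] .
  moreover have "nrm (T (f n)) \<le> C * B" for n
    using C(2)[OF f(1)[of n]] mult_left_mono[OF f(2)[of n], of C] C(1) by linarith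
  ultimately obtain r h where "strict_mono (r :: nat \<Rightarrow> nat)" "h \<in> X"
    "(\<lambda>n. nrm (\<lambda>i. K (T (f (r n))) i - h i)) \<longlonglongrightarrow> 0"
    by (rule compact_op_obtain[OF assms(1)])
  then show "\<exists>s :: nat \<Rightarrow> nat. \<exists>h'\<in>X. strict_mono s \<and> (\<lambda>n. nrm (\<lambda>i. K (T (f (s n))) i - h' i)) \<longlonglongrightarrow> 0"
    by blast
qed

lemma compact_op_zero: "compact_op X nrm (\<lambda>f i. 0)"
proof (rule compact_opI[OF linear_op_zero])
  have "nrm (\<lambda>i. 0) = 0" using nrm_zero_iff[OF zero_mem] by simp
  then show "\<exists>r :: nat \<Rightarrow> nat. \<exists>h\<in>X. strict_mono r \<and> (\<lambda>n. nrm (\<lambda>i. 0 - h i)) \<longlonglongrightarrow> 0"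
    using zero_mem by (intro exI[of _ id] bexI[of _ "\<lambda>i. 0"] conjI) (simp_all add: strict_mono_def)
qed

lemma compact_op_diff:
  assumes "compact_op X nrm J" "compact_op X nrm K"
  shows "compact_op X nrm (\<lambda>f i. J f i - K f i)"
proof -
  have "bounded_op X nrm (\<lambda>f i. (-1) * f i)"
    unfolding bounded_op_def linear_op_def using scale_mem[of _ "-1"] nrm_scale[of _ "-1"]
    by (auto intro!: exI[of _ 1])
  from compact_op_add[OF assms(1) compact_op_compose_left[OF this assms(2)]]
  show ?thesis by simp
qed

end

text \<open>
  Passes the submultiplicativity of the operator norm to the distances from the compact operators.
\<close>

lemma le_mult_cInf:
  fixes A B :: "real set"
  assumes "A \<noteq> {}" "B \<noteq> {}" "\<And>x. x \<in> A \<Longrightarrow> x \<ge> 0" "\<And>y. y \<in> B \<Longrightarrow> y \<ge> 0"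
    and "\<And>x y. x \<in> A \<Longrightarrow> y \<in> B \<Longrightarrow> c \<le> x * y"
  shows "c \<le> Inf A * Inf B"
proof -
  have step: "c \<le> Inf S * y" if "S \<noteq> {}" "y \<ge> 0" "\<And>x. x \<in> S \<Longrightarrow> c \<le> x * y" for S and y :: real
  proof (cases "y = 0")
    case True
    then show ?thesis using that by auto
  next
    case False
    then have "c / y \<le> Inf S"
      using that by (intro cInf_greatest) (auto simp: divide_le_eq)
    then show ?thesis using False that(2) by (simp add: divide_le_eq)
  qed
  have "c \<le> Inf A * y" if "y \<in> B" for y
    using step[OF assms(1) assms(4)[OF that]] assms(5) that by blast
  moreover have "Inf A \<ge> 0" using assms(1,3) by (intro cInf_greatest) auto
  ultimately show ?thesis using step[OF assms(2), of "Inf A"] by (simp add: mult.commute)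
qed

context sequence_space
begin

definition dist_compact :: "((nat \<Rightarrow> complex) \<Rightarrow> (nat \<Rightarrow> complex)) \<Rightarrow> real" where
  "dist_compact T = Inf {op_norm X nrm (\<lambda>f i. T f i - K f i) | K. compact_op X nrm K}"

lemma dist_compact_nonneg:
  assumes "bounded_op X nrm T"
  shows "dist_compact T \<ge> 0"
  unfolding dist_compact_def using compact_op_zero
  by (intro cInf_greatest) (auto intro!: op_norm_nonneg[OF bounded_op_diff[OF assms compact_op_bounded]])

lemma dist_compact_le:
  assumes "bounded_op X nrm T" "compact_op X nrm K"
  shows "dist_compact T \<le> op_norm X nrm (\<lambda>f i. T f i - K f i)"
  unfolding dist_compact_def using assms(2)
  by (intro cInf_lower bdd_belowI[where m = 0])
     (auto intro!: op_norm_nonneg[OF bounded_op_diff[OF assms(1) compact_op_bounded]])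

text \<open>
  The product \<open>(S - J) (T - K)\<close> differs from \<open>S T\<close> by \<open>S K + J T - J K\<close>, which is compact
  when \<open>J\<close> and \<open>K\<close> are.
\<close>

lemma dist_compact_mult:
  assumes S: "bounded_op X nrm S" and T: "bounded_op X nrm T"
  shows "dist_compact (\<lambda>f. S (T f)) \<le> dist_compact S * dist_compact T"
  unfolding dist_compact_def[of S] dist_compact_def[of T]
proof (rule le_mult_cInf)
  fix x y
  assume "x \<in> {op_norm X nrm (\<lambda>f i. S f i - K f i) | K. compact_op X nrm K}"
    and "y \<in> {op_norm X nrm (\<lambda>f i. T f i - K f i) | K. compact_op X nrm K}"
  then obtain J K where J: "compact_op X nrm J" "x = op_norm X nrm (\<lambda>f i. S f i - J f i)"
    and K: "compact_op X nrm K" "y = op_norm X nrm (\<lambda>f i. T f i - K f i)" by blast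
  define M where "M = (\<lambda>f i. S (K f) i + (J (T f) i - J (K f) i))"
  have M: "compact_op X nrm M"
    unfolding M_def
    using compact_op_add[OF compact_op_compose_left[OF S K(1)]
        compact_op_diff[OF compact_op_compose_right[OF J(1) T]
          compact_op_compose_right[OF J(1) compact_op_bounded[OF K(1)]]]] .
  have SJ: "bounded_op X nrm (\<lambda>f i. S f i - J f i)"
    using bounded_op_diff[OF S compact_op_bounded[OF J(1)]] .
  have TK: "bounded_op X nrm (\<lambda>f i. T f i - K f i)"
    using bounded_op_diff[OF T compact_op_bounded[OF K(1)]] .
  have "dist_compact (\<lambda>f. S (T f)) \<le> op_norm X nrm (\<lambda>f i. S (T f) i - M f i)"
    by (rule dist_compact_le[OF bounded_op_compose[OF S T] M])
  also have "\<dots> \<le> x * y"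
  proof (rule op_norm_le)
    fix f assume f: "f \<in> X"
    define g where "g = (\<lambda>i. T f i - K f i)"
    have Tf: "T f \<in> X" and Kf: "K f \<in> X"
      using linear_opD(1)[OF bounded_op_linear[OF T] f]
        linear_opD(1)[OF compact_op_linear[OF K(1)] f] by auto
    have g: "g \<in> X" unfolding g_def by (rule diff_mem[OF Tf Kf])
    have "(\<lambda>i. S (T f) i - M f i) = (\<lambda>i. S g i - J g i)"
      unfolding M_def g_def
      using linear_op_diffD[OF bounded_op_linear[OF S] Tf Kf]
        linear_op_diffD[OF compact_op_linear[OF J(1)] Tf Kf] by (simp add: algebra_simps)
    then have "nrm (\<lambda>i. S (T f) i - M f i) \<le> x * nrm g"
      using op_norm_ge[OF SJ g] J(2) by simp
    also have "\<dots> \<le> x * (y * nrm f)"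
      using op_norm_ge[OF TK f] op_norm_nonneg[OF SJ] J(2) K(2)
      by (intro mult_left_mono) (auto simp: g_def)
    finally show "nrm (\<lambda>i. S (T f) i - M f i) \<le> x * y * nrm f" by simp
  qed (use J K op_norm_nonneg[OF SJ] op_norm_nonneg[OF TK] in simp)
  finally show "dist_compact (\<lambda>f. S (T f)) \<le> x * y" .
qed (use compact_op_zero in \<open>auto intro!: op_norm_nonneg[OF bounded_op_diff[OF S compact_op_bounded]]
    op_norm_nonneg[OF bounded_op_diff[OF T compact_op_bounded]]\<close>)

text \<open>
  If \<open>T\<close> is within \<open>r\<close> of a compact operator then \<open>T ^ n\<close> is within \<open>r ^ n\<close> of one, by the
  same expansion of a product as above.
\<close>

lemma ess_spectral_radius_le:
  assumes T: "bounded_op X nrm T" and F: "compact_op X nrm F"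
    and r: "r \<ge> 0" and near: "\<And>f. f \<in> X \<Longrightarrow> nrm (\<lambda>i. T f i - F f i) \<le> r * nrm f"
  shows "ess_spectral_radius X nrm T \<le> r"
proof -
  have TX: "T f \<in> X" and FX: "F f \<in> X" if "f \<in> X" for f
    using linear_opD(1)[OF bounded_op_linear[OF T] that]
      linear_opD(1)[OF compact_op_linear[OF F] that] by auto
  have powX: "(T ^^ n) f \<in> X" if "f \<in> X" for f n
    using linear_opD(1)[OF bounded_op_linear[OF bounded_op_funpow[OF T]] that] .
  have approx: "\<exists>K. compact_op X nrm K \<and> (\<forall>f\<in>X. nrm (\<lambda>i. (T ^^ n) f i - K f i) \<le> r ^ n * nrm f)" for n
  proof (induction n)
    case 0
    then show ?case by (intro exI[of _ "\<lambda>f i. 0"]) (simp add: compact_op_zero)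
  next
    case (Suc n)
    then obtain K where K: "compact_op X nrm K"
      "\<And>f. f \<in> X \<Longrightarrow> nrm (\<lambda>i. (T ^^ n) f i - K f i) \<le> r ^ n * nrm f" by blast
    define M where "M = (\<lambda>f i. T (K f) i + (F ((T ^^ n) f) i - F (K f) i))"
    have M: "compact_op X nrm M"
      unfolding M_def
      using compact_op_add[OF compact_op_compose_left[OF T K(1)]
          compact_op_diff[OF compact_op_compose_right[OF F bounded_op_funpow[OF T]]
            compact_op_compose_right[OF F compact_op_bounded[OF K(1)]]]] .
    have "nrm (\<lambda>i. (T ^^ Suc n) f i - M f i) \<le> r ^ Suc n * nrm f" if f: "f \<in> X" for f
    proof -
      define g where "g = (\<lambda>i. (T ^^ n) f i - K f i)"
      have Kf: "K f \<in> X" using linear_opD(1)[OF compact_op_linear[OF K(1)] f] .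
      have g: "g \<in> X" unfolding g_def by (rule diff_mem[OF powX[OF f] Kf])
      have "(\<lambda>i. (T ^^ Suc n) f i - M f i) = (\<lambda>i. T g i - F g i)"
        unfolding M_def g_def
        using linear_op_diffD[OF bounded_op_linear[OF T] powX[OF f] Kf]
          linear_op_diffD[OF compact_op_linear[OF F] powX[OF f] Kf] by (simp add: algebra_simps)
      then have "nrm (\<lambda>i. (T ^^ Suc n) f i - M f i) \<le> r * nrm g" using near[OF g] by simp
      also have "\<dots> \<le> r * (r ^ n * nrm f)"
        using K(2)[OF f] r by (intro mult_left_mono) (auto simp: g_def)
      finally show ?thesis by simp
    qed
    then show ?case using M by blast
  qed
  define a where "a = (\<lambda>n. dist_compact (T ^^ n))"
  have a_nonneg: "a n \<ge> 0" for n
    unfolding a_def by (intro dist_compact_nonneg bounded_op_funpow T)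
  have a_le: "a n \<le> r ^ n" for n
  proof -
    obtain K where K: "compact_op X nrm K"
      "\<And>f. f \<in> X \<Longrightarrow> nrm (\<lambda>i. (T ^^ n) f i - K f i) \<le> r ^ n * nrm f"
      using approx[of n] by blast
    have "a n \<le> op_norm X nrm (\<lambda>f i. (T ^^ n) f i - K f i)"
      unfolding a_def by (intro dist_compact_le bounded_op_funpow T K)
    also have "\<dots> \<le> r ^ n" using K(2) r by (intro op_norm_le) auto
    finally show ?thesis .
  qed
  have "a (m + n) \<le> a m * a n" for m n
    using dist_compact_mult[OF bounded_op_funpow[OF T, of m] bounded_op_funpow[OF T, of n]]
    by (simp add: a_def funpow_add o_def)
  then have "convergent (\<lambda>n. root n (a n))"
    by (intro submultiplicative_root_convergent a_nonneg)
  then have "(\<lambda>n. root n (a n)) \<longlonglongrightarrow> ess_spectral_radius X nrm T"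
    unfolding ess_spectral_radius_def a_def dist_compact_def by (simp add: convergent_LIMSEQ_iff)
  then show ?thesis
  proof (rule tendsto_upperbound)
    show "eventually (\<lambda>n. root n (a n) \<le> r) sequentially"
      using eventually_ge_at_top[of 1]
    proof eventually_elim
      case (elim n)
      then have "root n (a n) \<le> root n (r ^ n)" using a_le by (intro real_root_le_mono) auto
      then show ?case using elim r by (simp add: real_root_power_cancel)
    qed
  qed simp
qed

text \<open>
  The images of a bounded sequence live in a fixed finite-dimensional coordinate space and stay
  bounded there, so Bolzano-Weierstrass, applied to one coordinate after another, yields a
  subsequence.
\<close>

lemma compact_op_finite_rank:
  assumes T: "bounded_op X nrm T"
  shows "compact_op X nrm (\<lambda>f i. if i < K then T f i else 0)"
proof (rule compact_opI)
  show "linear_op X (\<lambda>f i. if i < K then T f i else 0)"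
    unfolding linear_op_def
    using linear_opD(2,3)[OF bounded_op_linear[OF T]] by (auto intro: fin_supp_mem[of K])
next
  fix f B assume f: "\<And>n. f n \<in> X" "\<And>n::nat. nrm (f n) \<le> B"
  obtain C where C: "C > 0" "\<And>f. f \<in> X \<Longrightarrow> nrm (T f) \<le> C * nrm f"
    using bounded_op_obtain[OF T] by blast
  have TX: "T (f n) \<in> X" for n
    using linear_opD(1)[OF bounded_op_linear[OF T] f(1)] .
  have bd: "cmod (T (f n) i) \<le> C * B / w i" for n i
  proof -
    have "cmod (T (f n) i) * w i \<le> C * nrm (f n)"
      using coord_le[OF TX, of n i] C(2)[OF f(1), of n] by linarith
    also have "\<dots> \<le> C * B" using f C by (intro mult_left_mono) auto
    finally show ?thesis using w_pos[of i] by (simp add: le_divide_eq)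
  qed
  have "\<exists>r :: nat \<Rightarrow> nat. strict_mono r \<and> (\<forall>i<K. convergent (\<lambda>n. T (f (r n)) i))"
  proof (induction K)
    case 0
    then show ?case by (auto intro!: exI[of _ id] simp: strict_mono_def)
  next
    case (Suc K)
    then obtain r :: "nat \<Rightarrow> nat"
      where r: "strict_mono r" "\<And>i. i < K \<Longrightarrow> convergent (\<lambda>n. T (f (r n)) i)" by blast
    have "bounded (range (\<lambda>n. T (f (r n)) K))"
      using bd by (auto intro!: boundedI)
    then obtain l q where q: "strict_mono (q :: nat \<Rightarrow> nat)" "((\<lambda>n. T (f (r n)) K) \<circ> q) \<longlonglongrightarrow> l"
      using bounded_imp_convergent_subsequence by metis
    have "convergent (\<lambda>n. T (f ((r \<circ> q) n)) i)" if "i < Suc K" for i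
    proof (cases "i = K")
      case True
      then show ?thesis using q(2) by (auto simp: o_def convergent_def)
    next
      case False
      then show ?thesis using convergent_subseq_convergent[OF r(2) q(1), of i] that by (simp add: o_def)
    qed
    then show ?case using strict_mono_o[OF r(1) q(1)] by (intro exI[of _ "r \<circ> q"]) blast
  qed
  then obtain r :: "nat \<Rightarrow> nat" where r: "strict_mono r"
    "\<And>i. i < K \<Longrightarrow> convergent (\<lambda>n. T (f (r n)) i)" by blast
  define h where "h = (\<lambda>i. if i < K then lim (\<lambda>n. T (f (r n)) i) else 0)"
  define d where "d = (\<lambda>n i. (if i < K then T (f (r n)) i else 0) - h i)"
  have d: "d n i = 0" if "i \<ge> K" for n i using that by (simp add: d_def h_def)
  have d_lim: "(\<lambda>n. d n i) \<longlonglongrightarrow> 0" for i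
    using r(2)[of i] unfolding convergent_LIMSEQ_iff by (auto simp: d_def h_def intro: LIM_zero)
  have "(\<lambda>n. nrm (d n)) \<longlonglongrightarrow> 0"
  proof (rule real_tendsto_sandwich[OF _ _ tendsto_const])
    have "(\<lambda>n. \<Sum>i<K. cmod (d n i) * w i) \<longlonglongrightarrow> (\<Sum>i<K. cmod 0 * w i)"
      by (intro tendsto_intros d_lim)
    then show "(\<lambda>n. \<Sum>i<K. cmod (d n i) * w i) \<longlonglongrightarrow> 0" by simp
    show "eventually (\<lambda>n. nrm (d n) \<le> (\<Sum>i<K. cmod (d n i) * w i)) sequentially"
      using fin_supp_nrm[OF d] by simp
    show "eventually (\<lambda>n. 0 \<le> nrm (d n)) sequentially"
      using nrm_nonneg[OF fin_supp_mem[OF d]] by simp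
  qed
  moreover have "h \<in> X" by (rule fin_supp_mem[of K]) (simp add: h_def)
  ultimately show "\<exists>r :: nat \<Rightarrow> nat. \<exists>h\<in>X. strict_mono r \<and>
      (\<lambda>n. nrm (\<lambda>i. (if i < K then T (f (r n)) i else 0) - h i)) \<longlonglongrightarrow> 0"
    using r(1) by (intro exI[of _ r] bexI[of _ h]) (simp_all add: d_def)
qed

end

section \<open>The two sequence spaces\<close>

lemma l2_term_L2_set:
  "(\<Sum>i<n. (cmod (f i))\<^sup>2 * pmf \<pi> i) = (L2_set (\<lambda>i. cmod (f i) * sqrt (pmf \<pi> i)) {..<n})\<^sup>2"
  by (simp add: L2_set_def sum_nonneg power_mult_distrib)

lemma l2_partial_le:
  assumes "f \<in> l2_space \<pi>"
  shows "(\<Sum>i<n. (cmod (f i))\<^sup>2 * pmf \<pi> i) \<le> (l2_norm \<pi> f)\<^sup>2"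
proof -
  have "summable (\<lambda>i. (cmod (f i))\<^sup>2 * pmf \<pi> i)" using assms by (simp add: l2_space_def)
  then show ?thesis
    by (simp add: l2_norm_def sum_le_suminf suminf_nonneg)
qed

lemma l2_norm_nonneg: "l2_norm \<pi> f \<ge> 0" if "f \<in> l2_space \<pi>"
  using that by (auto simp: l2_norm_def l2_space_def intro!: suminf_nonneg)

text \<open>
  All estimates in \<open>\<ell>\<^sup>2(\<pi>)\<close> below are estimates of finite partial sums.
\<close>

lemma l2I:
  assumes "\<And>n. (\<Sum>i<n. (cmod (f i))\<^sup>2 * pmf \<pi> i) \<le> B\<^sup>2" "B \<ge> 0"
  shows "f \<in> l2_space \<pi>" "l2_norm \<pi> f \<le> B"
proof -
  have s: "summable (\<lambda>i. (cmod (f i))\<^sup>2 * pmf \<pi> i)"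
    by (rule summableI_nonneg_bounded[OF _ assms(1)]) simp
  then show "f \<in> l2_space \<pi>" by (simp add: l2_space_def)
  have "(\<Sum>i. (cmod (f i))\<^sup>2 * pmf \<pi> i) \<le> B\<^sup>2"
    by (rule suminf_le_const[OF s assms(1)])
  then show "l2_norm \<pi> f \<le> B"
    unfolding l2_norm_def using assms(2) by (metis real_sqrt_le_mono real_sqrt_unique)
qed

lemma l2_L2_set_le:
  assumes "f \<in> l2_space \<pi>"
  shows "L2_set (\<lambda>i. cmod (f i) * sqrt (pmf \<pi> i)) {..<n} \<le> l2_norm \<pi> f"
  using l2_partial_le[OF assms, of n] l2_norm_nonneg[OF assms]
  unfolding l2_term_L2_set by (rule power2_le_imp_le)

lemma l2I_L2_set:
  assumes "\<And>n. L2_set (\<lambda>i. cmod (f i) * sqrt (pmf \<pi> i)) {..<n} \<le> B" "B \<ge> 0"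
  shows "f \<in> l2_space \<pi>" "l2_norm \<pi> f \<le> B"
  using assms by (intro l2I; auto simp: l2_term_L2_set intro!: power_mono L2_set_nonneg)+

lemma sequence_space_l2:
  assumes pos: "\<And>i. pmf \<pi> i > 0"
  shows "sequence_space (l2_space \<pi>) (l2_norm \<pi>) (\<lambda>i. sqrt (pmf \<pi> i))"
proof
  show "sqrt (pmf \<pi> i) > 0" for i using pos by simp
next
  fix f g assume fg: "f \<in> l2_space \<pi>" "g \<in> l2_space \<pi>"
  have "L2_set (\<lambda>i. cmod (f i + g i) * sqrt (pmf \<pi> i)) {..<n} \<le> l2_norm \<pi> f + l2_norm \<pi> g" for n
  proof -
    have "L2_set (\<lambda>i. cmod (f i + g i) * sqrt (pmf \<pi> i)) {..<n} \<le>
      L2_set (\<lambda>i. cmod (f i) * sqrt (pmf \<pi> i) + cmod (g i) * sqrt (pmf \<pi> i)) {..<n}"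
      by (intro L2_set_mono) (auto simp: distrib_right[symmetric] intro!: mult_right_mono norm_triangle_ineq)
    also have "\<dots> \<le> L2_set (\<lambda>i. cmod (f i) * sqrt (pmf \<pi> i)) {..<n}
        + L2_set (\<lambda>i. cmod (g i) * sqrt (pmf \<pi> i)) {..<n}" by (rule L2_set_triangle_ineq)
    finally show ?thesis using l2_L2_set_le[OF fg(1), of n] l2_L2_set_le[OF fg(2), of n] by linarith
  qed
  from l2I_L2_set[OF this] l2_norm_nonneg[OF fg(1)] l2_norm_nonneg[OF fg(2)]
  show "(\<lambda>i. f i + g i) \<in> l2_space \<pi>" "l2_norm \<pi> (\<lambda>i. f i + g i) \<le> l2_norm \<pi> f + l2_norm \<pi> g"
    by auto
next
  fix f c assume f: "f \<in> l2_space \<pi>"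
  have s: "summable (\<lambda>i. (cmod (f i))\<^sup>2 * pmf \<pi> i)" using f by (simp add: l2_space_def)
  have eq: "(cmod (c * f i))\<^sup>2 * pmf \<pi> i = (cmod c)\<^sup>2 * ((cmod (f i))\<^sup>2 * pmf \<pi> i)" for i
    by (simp add: norm_mult power_mult_distrib)
  show "(\<lambda>i. c * f i) \<in> l2_space \<pi>"
    unfolding l2_space_def mem_Collect_eq eq by (rule summable_mult[OF s])
  show "l2_norm \<pi> (\<lambda>i. c * f i) = cmod c * l2_norm \<pi> f"
    unfolding l2_norm_def eq suminf_mult[OF s] by (simp add: real_sqrt_mult)
next
  fix f i assume f: "f \<in> l2_space \<pi>"
  have "cmod (f i) * sqrt (pmf \<pi> i) \<le> L2_set (\<lambda>i. cmod (f i) * sqrt (pmf \<pi> i)) {..<Suc i}"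
    by (rule member_le_L2_set) auto
  then show "cmod (f i) * sqrt (pmf \<pi> i) \<le> l2_norm \<pi> f" using l2_L2_set_le[OF f, of "Suc i"] by linarith
next
  fix K :: nat and f :: "nat \<Rightarrow> complex" assume f: "\<And>i. i \<ge> K \<Longrightarrow> f i = 0"
  have "L2_set (\<lambda>i. cmod (f i) * sqrt (pmf \<pi> i)) {..<n} \<le> (\<Sum>i<K. cmod (f i) * sqrt (pmf \<pi> i))" for n
  proof -
    have "L2_set (\<lambda>i. cmod (f i) * sqrt (pmf \<pi> i)) {..<n} \<le> (\<Sum>i<n. cmod (f i) * sqrt (pmf \<pi> i))"
      by (rule L2_set_le_sum) auto
    also have "\<dots> = (\<Sum>i\<in>{..<n} \<inter> {..<K}. cmod (f i) * sqrt (pmf \<pi> i))"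
      using f by (intro sum.mono_neutral_right) (auto simp: not_less[symmetric])
    also have "\<dots> \<le> (\<Sum>i<K. cmod (f i) * sqrt (pmf \<pi> i))" by (rule sum_mono2) auto
    finally show ?thesis .
  qed
  moreover have "(\<Sum>i<K. cmod (f i) * sqrt (pmf \<pi> i)) \<ge> 0" by (intro sum_nonneg) auto
  ultimately show "f \<in> l2_space \<pi>" "l2_norm \<pi> f \<le> (\<Sum>i<K. cmod (f i) * sqrt (pmf \<pi> i))"
    using l2I_L2_set by blast+
qed

lemma weight_eq: "pmf \<pi> i > 0 \<Longrightarrow> x / weight \<pi> i = x * sqrt (pmf \<pi> i)"
  by (simp add: weight_def powr_minus_divide powr_half_sqrt)

lemma BV_coord_le:
  assumes "\<And>i. pmf \<pi> i > 0" "f \<in> BV_space (weight \<pi>)"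
  shows "cmod (f i) * sqrt (pmf \<pi> i) \<le> BV_norm (weight \<pi>) f"
  using assms(2) unfolding BV_norm_def weight_eq[OF assms(1), symmetric]
  by (intro cSUP_upper) (auto simp: BV_space_def)

lemma BVI:
  assumes "\<And>i. pmf \<pi> i > 0" "\<And>i. cmod (f i) * sqrt (pmf \<pi> i) \<le> B"
  shows "f \<in> BV_space (weight \<pi>)" "BV_norm (weight \<pi>) f \<le> B"
  using assms(2) unfolding BV_norm_def BV_space_def weight_eq[OF assms(1), symmetric]
  by (auto intro!: bdd_aboveI[where M = B] cSUP_least)

lemma sequence_space_BV:
  assumes pos: "\<And>i. pmf \<pi> i > 0"
  shows "sequence_space (BV_space (weight \<pi>)) (BV_norm (weight \<pi>)) (\<lambda>i. sqrt (pmf \<pi> i))"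
proof
  show "sqrt (pmf \<pi> i) > 0" for i using pos by simp
next
  fix f g assume fg: "f \<in> BV_space (weight \<pi>)" "g \<in> BV_space (weight \<pi>)"
  have "cmod (f i + g i) * sqrt (pmf \<pi> i) \<le> BV_norm (weight \<pi>) f + BV_norm (weight \<pi>) g" for i
    using BV_coord_le[OF pos fg(1), of i] BV_coord_le[OF pos fg(2), of i]
      mult_right_mono[OF norm_triangle_ineq[of "f i" "g i"], of "sqrt (pmf \<pi> i)"]
    by (simp add: distrib_right)
  from BVI[OF pos this]
  show "(\<lambda>i. f i + g i) \<in> BV_space (weight \<pi>)"
    "BV_norm (weight \<pi>) (\<lambda>i. f i + g i) \<le> BV_norm (weight \<pi>) f + BV_norm (weight \<pi>) g" by auto
next
  fix f and c :: complex assume f: "f \<in> BV_space (weight \<pi>)"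
  have le: "(\<lambda>i. a * g i) \<in> BV_space (weight \<pi>)"
    "BV_norm (weight \<pi>) (\<lambda>i. a * g i) \<le> cmod a * BV_norm (weight \<pi>) g"
    if "g \<in> BV_space (weight \<pi>)" for g a
  proof -
    have "cmod (a * g i) * sqrt (pmf \<pi> i) \<le> cmod a * BV_norm (weight \<pi>) g" for i
      using mult_left_mono[OF BV_coord_le[OF pos that, of i], of "cmod a"]
      by (simp add: norm_mult mult_ac)
    from BVI[OF pos this] show "(\<lambda>i. a * g i) \<in> BV_space (weight \<pi>)"
      "BV_norm (weight \<pi>) (\<lambda>i. a * g i) \<le> cmod a * BV_norm (weight \<pi>) g" by auto
  qed
  show cf: "(\<lambda>i. c * f i) \<in> BV_space (weight \<pi>)" by (rule le(1)[OF f])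
  show "BV_norm (weight \<pi>) (\<lambda>i. c * f i) = cmod c * BV_norm (weight \<pi>) f"
  proof (cases "c = 0")
    case True
    then show ?thesis by (simp add: BV_norm_def)
  next
    case False
    have "BV_norm (weight \<pi>) f \<le> cmod (inverse c) * BV_norm (weight \<pi>) (\<lambda>i. c * f i)"
      using le(2)[OF cf, of "inverse c"] False by (simp add: mult.assoc[symmetric])
    from mult_left_mono[OF this norm_ge_zero[of c]]
    have "cmod c * BV_norm (weight \<pi>) f
        \<le> cmod (c * inverse c) * BV_norm (weight \<pi>) (\<lambda>i. c * f i)"
      by (simp only: norm_mult mult.assoc)
    then have "cmod c * BV_norm (weight \<pi>) f \<le> BV_norm (weight \<pi>) (\<lambda>i. c * f i)"
      using False by simp
    then show ?thesis using le(2)[OF f, of c] by simp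
  qed
next
  fix f i assume "f \<in> BV_space (weight \<pi>)"
  then show "cmod (f i) * sqrt (pmf \<pi> i) \<le> BV_norm (weight \<pi>) f" by (rule BV_coord_le[OF pos])
next
  fix K :: nat and f :: "nat \<Rightarrow> complex" assume f: "\<And>i. i \<ge> K \<Longrightarrow> f i = 0"
  have "cmod (f i) * sqrt (pmf \<pi> i) \<le> (\<Sum>i<K. cmod (f i) * sqrt (pmf \<pi> i))" for i
  proof (cases "i < K")
    case True
    then show ?thesis by (intro member_le_sum) auto
  next
    case False
    then show ?thesis using f by (auto intro!: sum_nonneg)
  qed
  from BVI[OF pos this]
  show "f \<in> BV_space (weight \<pi>)" "BV_norm (weight \<pi>) f \<le> (\<Sum>i<K. cmod (f i) * sqrt (pmf \<pi> i))"
    by auto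
qed

lemma sum_pmf_le_1: "(\<Sum>i\<in>I. pmf p i) \<le> 1" if "finite I"
  using measure_measure_pmf_finite[OF that, of p] by (metis measure_pmf.prob_le_1)

lemma summable_pmf_nat: "summable (pmf (p :: nat pmf))"
  by (rule summableI_nonneg_bounded[where x = 1]) (auto simp: sum_pmf_le_1)

lemma suminf_pmf_nat: "(\<Sum>i. pmf (p :: nat pmf) i) = 1"
  using sums_integral_count_space_nat[OF integrable_pmf, of p]
  by (simp add: integral_pmf sums_iff)

section \<open>Reversible kernels with finite band width\<close>

text \<open>
  The variance of \<open>z\<close> under the weights \<open>p\<close> is at least the contribution of the two points \<open>a\<close>
  and \<open>b\<close>, and \<open>p a * x\<^sup>2 + p b * y\<^sup>2 \<ge> p a * p b * (x + y)\<^sup>2\<close> because \<open>p a + p b \<le> 1\<close>.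
\<close>

lemma variance_two_points:
  fixes z :: "nat \<Rightarrow> complex" and p :: "nat \<Rightarrow> real"
  assumes J: "finite J" "a \<in> J" "b \<in> J" and p: "\<And>j. j \<in> J \<Longrightarrow> p j \<ge> 0" "sum p J = 1"
  shows "(cmod (\<Sum>j\<in>J. of_real (p j) * z j))\<^sup>2 + p a * p b * (cmod (z a - z b))\<^sup>2
    \<le> (\<Sum>j\<in>J. p j * (cmod (z j))\<^sup>2)"
proof -
  define c where "c = (\<Sum>j\<in>J. of_real (p j) * z j)"
  have re: "Re c = (\<Sum>j\<in>J. p j * Re (z j))" and im: "Im c = (\<Sum>j\<in>J. p j * Im (z j))"
    by (simp_all add: c_def)
  have sq: "(cmod x)\<^sup>2 = (Re x)\<^sup>2 + (Im x)\<^sup>2" for x by (simp add: cmod_power2)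
  have "(\<Sum>j\<in>J. p j * (cmod (z j - c))\<^sup>2) =
      (\<Sum>j\<in>J. p j * (cmod (z j))\<^sup>2 - 2 * (Re c * (p j * Re (z j))) - 2 * (Im c * (p j * Im (z j)))
        + p j * (cmod c)\<^sup>2)"
    unfolding sq minus_complex.sel by (intro sum.cong refl) (simp add: power2_eq_square algebra_simps)
  also have "\<dots> = (\<Sum>j\<in>J. p j * (cmod (z j))\<^sup>2) - 2 * (Re c * Re c) - 2 * (Im c * Im c)
      + 1 * (cmod c)\<^sup>2"
    unfolding re im p(2)[symmetric]
    by (simp add: sum.distrib sum_subtractf sum_distrib_left[symmetric] sum_distrib_right[symmetric])
  also have "\<dots> = (\<Sum>j\<in>J. p j * (cmod (z j))\<^sup>2) - (cmod c)\<^sup>2"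
    using sq[of c] by (simp add: power2_eq_square)
  finally have var: "(\<Sum>j\<in>J. p j * (cmod (z j - c))\<^sup>2) = (\<Sum>j\<in>J. p j * (cmod (z j))\<^sup>2) - (cmod c)\<^sup>2" .
  show ?thesis
  proof (cases "a = b")
    case True
    have "(\<Sum>j\<in>J. p j * (cmod (z j - c))\<^sup>2) \<ge> 0" using p by (intro sum_nonneg) auto
    then show ?thesis using var True by (simp add: c_def)
  next
    case False
    define x where "x = cmod (z a - c)"
    define y where "y = cmod (z b - c)"
    have "p a + p b = sum p {a, b}" using False by simp
    also have "\<dots> \<le> 1" using J p(1) unfolding p(2)[symmetric] by (intro sum_mono2) auto
    finally have le1: "p a + p b \<le> 1" .
    have "cmod (z a - z b) \<le> x + y"
      using norm_triangle_ineq4[of "z a - c" "z b - c"] by (simp add: x_def y_def)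
    then have "p a * p b * (cmod (z a - z b))\<^sup>2 \<le> p a * p b * (x + y)\<^sup>2"
      using J p by (intro mult_left_mono power_mono) auto
    also have "\<dots> = (p a + p b) * (p a * x\<^sup>2 + p b * y\<^sup>2) - (p a * x - p b * y)\<^sup>2"
      by (simp add: power2_eq_square algebra_simps)
    also have "\<dots> \<le> 1 * (p a * x\<^sup>2 + p b * y\<^sup>2)"
      by (rule order_trans[OF _ mult_right_mono[OF le1]]) (use J p in auto)
    also have "\<dots> = (\<Sum>j\<in>{a,b}. p j * (cmod (z j - c))\<^sup>2)" using False by (simp add: x_def y_def)
    also have "\<dots> \<le> (\<Sum>j\<in>J. p j * (cmod (z j - c))\<^sup>2)" using J p by (intro sum_mono2) auto
    finally show ?thesis using var by (simp add: c_def)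
  qed
qed

text \<open>
  The band condition is one-sided and holds for every row; reversibility supplies the other side.
\<close>

locale reversible_band_kernel =
  fixes P :: "nat \<Rightarrow> nat pmf" and \<pi> :: "nat pmf" and L :: nat
  assumes pos: "pmf \<pi> i > 0"
    and reversible: "pmf \<pi> i * pmf (P i) j = pmf \<pi> j * pmf (P j) i"
    and band: "i + L < j \<Longrightarrow> pmf (P i) j = 0"
begin

sublocale l2: sequence_space "l2_space \<pi>" "l2_norm \<pi>" "\<lambda>i. sqrt (pmf \<pi> i)"
  by (rule sequence_space_l2[OF pos])

sublocale BV: sequence_space "BV_space (weight \<pi>)" "BV_norm (weight \<pi>)" "\<lambda>i. sqrt (pmf \<pi> i)"
  by (rule sequence_space_BV[OF pos])

lemma positive_sym: "pmf (P i) j > 0 \<longleftrightarrow> pmf (P j) i > 0"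
  using reversible[of i j] pos[of i] pos[of j] by (metis mult_pos_pos pmf_nonneg zero_less_mult_pos)

lemma band_below: "j + L < i \<Longrightarrow> pmf (P i) j = 0"
  using positive_sym[of i j] band[of j i] by (simp add: pmf_eq_0_set_pmf pmf_positive_iff)

text \<open>
  The matrix of \<open>P\<close> after conjugation with multiplication by \<open>sqrt \<pi>\<close>, by \<open>P_sqrt_eq\<close>.
\<close>

definition s :: "nat \<Rightarrow> nat \<Rightarrow> real" where
  "s i j = sqrt (pmf (P i) j * pmf (P j) i)"

lemma s_nonneg: "s i j \<ge> 0"
  by (simp add: s_def)

lemma s_sym: "s i j = s j i"
  by (simp add: s_def mult.commute)

lemma s_le_1: "s i j \<le> 1"
  by (simp add: s_def mult_le_one pmf_le_1)

lemma s_band: "i + L < j \<or> j + L < i \<Longrightarrow> s i j = 0"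
  using band band_below by (auto simp: s_def)

lemma P_sqrt_eq: "pmf (P i) j * sqrt (pmf \<pi> i) = s i j * sqrt (pmf \<pi> j)"
proof -
  have "(pmf (P i) j * sqrt (pmf \<pi> i))\<^sup>2 = pmf (P i) j * (pmf \<pi> i * pmf (P i) j)"
    by (simp add: power_mult_distrib power2_eq_square)
  also have "\<dots> = (s i j * sqrt (pmf \<pi> j))\<^sup>2"
    unfolding reversible[of i j] by (simp add: s_def power_mult_distrib mult_ac)
  finally show ?thesis by (simp add: power2_eq_iff_nonneg s_nonneg)
qed

lemma kernel_op_eq: "i + L \<le> m \<Longrightarrow> kernel_op P f i = (\<Sum>j\<le>m. of_real (pmf (P i) j) * f j)"
  unfolding kernel_op_def using band[of i] by (intro suminf_finite) auto

lemma row_sum: "i + L \<le> m \<Longrightarrow> (\<Sum>j\<le>m. pmf (P i) j) = 1"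
  using band[of i] by (intro sum_pmf_eq_1) (auto simp: set_pmf_iff not_le[symmetric] intro: ccontr)

lemma kernel_op_add: "kernel_op P (\<lambda>i. f i + g i) = (\<lambda>i. kernel_op P f i + kernel_op P g i)"
  by (rule ext) (simp add: kernel_op_eq[OF order_refl] algebra_simps sum.distrib)

lemma kernel_op_diff: "kernel_op P (\<lambda>i. f i - g i) = (\<lambda>i. kernel_op P f i - kernel_op P g i)"
  by (rule ext) (simp add: kernel_op_eq[OF order_refl] algebra_simps sum_subtractf)

lemma kernel_op_scale: "kernel_op P (\<lambda>i. c * f i) = (\<lambda>i. c * kernel_op P f i)"
  by (rule ext) (simp add: kernel_op_eq[OF order_refl] algebra_simps sum_distrib_left)

lemma kernel_op_const: "kernel_op P (\<lambda>i. c) = (\<lambda>i. c)"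
  by (rule ext) (simp add: kernel_op_eq[OF order_refl] sum_distrib_right[symmetric] row_sum
      of_real_sum[symmetric] del: of_real_sum)

lemma column_sum_le: "finite I \<Longrightarrow> (\<Sum>i\<in>I. pmf \<pi> i * pmf (P i) j) \<le> pmf \<pi> j"
  using mult_left_mono[OF sum_pmf_le_1[of I "P j"], of "pmf \<pi> j"]
  by (simp add: reversible sum_distrib_left)

lemma kernel_op_coord:
  assumes "i + L \<le> m"
  shows "cmod (kernel_op P f i) * sqrt (pmf \<pi> i) \<le> (\<Sum>j\<le>m. s i j * (cmod (f j) * sqrt (pmf \<pi> j)))"
proof -
  have "cmod (kernel_op P f i) * sqrt (pmf \<pi> i)
      \<le> (\<Sum>j\<le>m. pmf (P i) j * cmod (f j)) * sqrt (pmf \<pi> i)"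
    unfolding kernel_op_eq[OF assms]
    by (intro mult_right_mono sum_norm_le) (auto simp: norm_mult)
  also have "\<dots> = (\<Sum>j\<le>m. (pmf (P i) j * sqrt (pmf \<pi> i)) * cmod (f j))"
    by (simp add: sum_distrib_left mult_ac)
  also have "\<dots> = (\<Sum>j\<le>m. s i j * (cmod (f j) * sqrt (pmf \<pi> j)))"
    unfolding P_sqrt_eq by (simp add: mult_ac)
  finally show ?thesis .
qed

text \<open>
  The inequality \<open>\<bar>P f\<bar>\<^sup>2 \<le> P \<bar>f\<bar>\<^sup>2\<close>, sharpened in row \<open>k\<close> by the two-point bound on the variance, is
  summed against \<open>\<pi>\<close>; the column sums of \<open>\<pi>(i) P(i,j)\<close> are at most \<open>\<pi>(j)\<close>.
\<close>

lemma l2_defect: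
  assumes f: "f \<in> l2_space \<pi>"
  shows "kernel_op P f \<in> l2_space \<pi>"
    and "(l2_norm \<pi> (kernel_op P f))\<^sup>2 + pmf \<pi> k * (pmf (P k) a * pmf (P k) b * (cmod (f a - f b))\<^sup>2)
      \<le> (l2_norm \<pi> f)\<^sup>2"
proof -
  define D where "D k a b = pmf \<pi> k * (pmf (P k) a * pmf (P k) b * (cmod (f a - f b))\<^sup>2)" for k a b
  have le: "(\<Sum>i<n. (cmod (kernel_op P f i))\<^sup>2 * pmf \<pi> i) + D k a b \<le> (l2_norm \<pi> f)\<^sup>2"
    if n: "n > k" for n k a b
  proof -
    \<comment> \<open>large enough to contain the supports of the rows below n as well as a and b\<close>
    define m where "m = n + L + a + b"
    have var: "(cmod (kernel_op P f i))\<^sup>2 + pmf (P i) c * pmf (P i) d * (cmod (f c - f d))\<^sup>2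
        \<le> (\<Sum>j\<le>m. pmf (P i) j * (cmod (f j))\<^sup>2)" if "i < n" "c \<le> m" "d \<le> m" for i c d
      using variance_two_points[of "{..m}" c d "pmf (P i)" f] that row_sum[of i m] kernel_op_eq[of i m f]
      by (simp add: m_def)
    have "(\<Sum>i<n. (cmod (kernel_op P f i))\<^sup>2 * pmf \<pi> i) + D k a b
        = (\<Sum>i<n. pmf \<pi> i * ((cmod (kernel_op P f i))\<^sup>2
            + (if i = k then pmf (P i) a * pmf (P i) b * (cmod (f a - f b))\<^sup>2 else 0)))"
      using n by (simp add: distrib_left sum.distrib D_def if_distrib[of "\<lambda>x. _ * x"] mult.commute
          sum.delta cong: if_cong)
    also have "\<dots> \<le> (\<Sum>i<n. pmf \<pi> i * (\<Sum>j\<le>m. pmf (P i) j * (cmod (f j))\<^sup>2))"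
    proof (intro sum_mono mult_left_mono)
      fix i assume i: "i \<in> {..<n}"
      have "a \<le> m" "b \<le> m" by (auto simp: m_def)
      then show "(cmod (kernel_op P f i))\<^sup>2
          + (if i = k then pmf (P i) a * pmf (P i) b * (cmod (f a - f b))\<^sup>2 else 0)
          \<le> (\<Sum>j\<le>m. pmf (P i) j * (cmod (f j))\<^sup>2)"
        using var[of i a b] var[of i 0 0] i by auto
    qed simp
    also have "\<dots> = (\<Sum>j\<le>m. (\<Sum>i<n. pmf \<pi> i * pmf (P i) j) * (cmod (f j))\<^sup>2)"
      unfolding sum_distrib_left sum_distrib_right by (subst sum.swap) (simp add: mult_ac)
    also have "\<dots> \<le> (\<Sum>j\<le>m. pmf \<pi> j * (cmod (f j))\<^sup>2)"
      by (intro sum_mono mult_right_mono column_sum_le) auto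
    also have "\<dots> \<le> (l2_norm \<pi> f)\<^sup>2"
      using l2_partial_le[OF f, of "Suc m"] by (simp add: lessThan_Suc_atMost mult.commute)
    finally show ?thesis .
  qed
  have *: "kernel_op P f \<in> l2_space \<pi> \<and>
      (l2_norm \<pi> (kernel_op P f))\<^sup>2 + D k a b \<le> (l2_norm \<pi> f)\<^sup>2" for k a b
  proof -
    define B where "B = sqrt ((l2_norm \<pi> f)\<^sup>2 - D k a b)"
    have D: "D k a b \<ge> 0" by (simp add: D_def)
    have part: "(\<Sum>i<n. (cmod (kernel_op P f i))\<^sup>2 * pmf \<pi> i) \<le> (l2_norm \<pi> f)\<^sup>2 - D k a b" for n
    proof -
      have "(\<Sum>i<n. (cmod (kernel_op P f i))\<^sup>2 * pmf \<pi> i)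
          \<le> (\<Sum>i<n + Suc k. (cmod (kernel_op P f i))\<^sup>2 * pmf \<pi> i)"
        by (intro sum_mono2) auto
      then show ?thesis using le[of k "n + Suc k" a b] by linarith
    qed
    have nn: "(l2_norm \<pi> f)\<^sup>2 - D k a b \<ge> 0" using part[of 0] by simp
    have B: "B \<ge> 0" "B\<^sup>2 = (l2_norm \<pi> f)\<^sup>2 - D k a b"
      using nn by (simp_all add: B_def)
    from l2I[of "kernel_op P f" \<pi> B] part B
    have "kernel_op P f \<in> l2_space \<pi>" "l2_norm \<pi> (kernel_op P f) \<le> B" by auto
    moreover from this have "(l2_norm \<pi> (kernel_op P f))\<^sup>2 \<le> B\<^sup>2"
      by (intro power_mono l2_norm_nonneg)
    ultimately show ?thesis using B by simp
  qed
  show "kernel_op P f \<in> l2_space \<pi>" using * by blast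
  show "(l2_norm \<pi> (kernel_op P f))\<^sup>2 + pmf \<pi> k * (pmf (P k) a * pmf (P k) b * (cmod (f a - f b))\<^sup>2)
      \<le> (l2_norm \<pi> f)\<^sup>2"
    using *[of k a b] by (simp add: D_def)
qed

lemma l2_contraction: "f \<in> l2_space \<pi> \<Longrightarrow> l2_norm \<pi> (kernel_op P f) \<le> l2_norm \<pi> f"
  using l2_defect(2)[of f 0 0 0] by (intro power2_le_imp_le[OF _ l2_norm_nonneg]) auto

lemma bounded_l2: "bounded_l2 P \<pi>"
  unfolding bounded_op_def linear_op_def
  using l2_defect(1) l2_contraction kernel_op_add kernel_op_scale by (auto intro!: exI[of _ 1])

lemma s_row_sum_le: "(\<Sum>j\<le>m. s i j) \<le> real (2 * L + 1)"
proof -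
  have "(\<Sum>j\<le>m. s i j) = (\<Sum>j\<in>{..m} \<inter> {i - L..i + L}. s i j)"
    by (intro sum.mono_neutral_right) (auto intro!: s_band)
  also have "\<dots> \<le> (\<Sum>j\<in>{i - L..i + L}. s i j)"
    by (intro sum_mono2) (auto simp: s_nonneg)
  also have "\<dots> \<le> real (card {i - L..i + L}) * 1"
    by (rule sum_bounded_above) (simp add: s_le_1)
  also have "\<dots> \<le> real (2 * L + 1)" by simp
  finally show ?thesis .
qed

lemma BV_kernel_coord:
  assumes f: "f \<in> BV_space (weight \<pi>)" and r: "\<And>m. (\<Sum>j\<le>m. s i j) \<le> r"
  shows "cmod (kernel_op P f i) * sqrt (pmf \<pi> i) \<le> r * BV_norm (weight \<pi>) f"
proof -
  have "cmod (kernel_op P f i) * sqrt (pmf \<pi> i)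
      \<le> (\<Sum>j\<le>i + L. s i j * (cmod (f j) * sqrt (pmf \<pi> j)))"
    by (rule kernel_op_coord) simp
  also have "\<dots> \<le> (\<Sum>j\<le>i + L. s i j * BV_norm (weight \<pi>) f)"
    by (intro sum_mono mult_left_mono BV.coord_le f s_nonneg)
  also have "\<dots> \<le> r * BV_norm (weight \<pi>) f"
    using r BV.nrm_nonneg[OF f] by (simp add: sum_distrib_right[symmetric] mult_right_mono)
  finally show ?thesis .
qed

lemma BV_kernel:
  assumes f: "f \<in> BV_space (weight \<pi>)"
  shows "kernel_op P f \<in> BV_space (weight \<pi>)"
    and "BV_norm (weight \<pi>) (kernel_op P f) \<le> real (2 * L + 1) * BV_norm (weight \<pi>) f"
  using BVI[OF pos BV_kernel_coord[OF f s_row_sum_le]] by auto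

lemma bounded_V: "bounded_V P \<pi>"
  unfolding bounded_op_def linear_op_def
  using BV_kernel kernel_op_add kernel_op_scale by (auto intro!: exI[of _ "real (2 * L + 1)"])

text \<open>
  The hypothesis of Schur's test for the matrix obtained from \<open>s\<close> by erasing the rows below \<open>K\<close>.
\<close>

definition tail_bound :: "nat \<Rightarrow> real \<Rightarrow> bool" where
  "tail_bound K r \<longleftrightarrow>
     (\<forall>i\<ge>K. \<forall>m. (\<Sum>j\<le>m. s i j) \<le> r) \<and> (\<forall>j n. (\<Sum>i\<in>{K..<n}. s i j) \<le> r)"

definition tail :: "nat \<Rightarrow> (nat \<Rightarrow> complex) \<Rightarrow> nat \<Rightarrow> complex" where
  "tail K f i = (if i < K then 0 else kernel_op P f i)"

definition head :: "nat \<Rightarrow> (nat \<Rightarrow> complex) \<Rightarrow> nat \<Rightarrow> complex" where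
  "head K f i = (if i < K then kernel_op P f i else 0)"

lemma kernel_op_split: "kernel_op P f = (\<lambda>i. tail K f i + head K f i)"
  by (auto simp: tail_def head_def)

lemma head_supp: "i \<ge> K \<Longrightarrow> head K f i = 0"
  by (simp add: head_def)

lemma tail_bound_nonneg: "tail_bound K r \<Longrightarrow> r \<ge> 0"
  unfolding tail_bound_def using s_nonneg by (meson order_refl order_trans sum_nonneg)

lemma tail_BV:
  assumes "tail_bound K r" "f \<in> BV_space (weight \<pi>)"
  shows "tail K f \<in> BV_space (weight \<pi>)" "BV_norm (weight \<pi>) (tail K f) \<le> r * BV_norm (weight \<pi>) f"
proof -
  have "cmod (tail K f i) * sqrt (pmf \<pi> i) \<le> r * BV_norm (weight \<pi>) f" for i
    using BV_kernel_coord[OF assms(2), of i r] assms tail_bound_nonneg[OF assms(1)]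
      BV.nrm_nonneg[OF assms(2)] by (auto simp: tail_def tail_bound_def)
  from BVI[OF pos this]
  show "tail K f \<in> BV_space (weight \<pi>)" "BV_norm (weight \<pi>) (tail K f) \<le> r * BV_norm (weight \<pi>) f"
    by auto
qed

text \<open>
  Schur's test for the truncated matrix: Cauchy-Schwarz along each row costs a factor \<open>r\<close>, and
  the exchange of the sums another one, through the column sums.
\<close>

lemma tail_l2:
  assumes tb: "tail_bound K r" and f: "f \<in> l2_space \<pi>"
  shows "tail K f \<in> l2_space \<pi>" "l2_norm \<pi> (tail K f) \<le> r * l2_norm \<pi> f"
proof -
  define u where "u j = cmod (f j) * sqrt (pmf \<pi> j)" for j
  note r = tail_bound_nonneg[OF tb]
  have "(\<Sum>i<n. (cmod (tail K f i))\<^sup>2 * pmf \<pi> i) \<le> (r * l2_norm \<pi> f)\<^sup>2" for n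
  proof -
    define m where "m = n + L"
    have row: "(cmod (kernel_op P f i))\<^sup>2 * pmf \<pi> i \<le> r * (\<Sum>j\<le>m. s i j * (u j)\<^sup>2)"
      if i: "i \<ge> K" "i < n" for i
    proof -
      have "(cmod (kernel_op P f i))\<^sup>2 * pmf \<pi> i = (cmod (kernel_op P f i) * sqrt (pmf \<pi> i))\<^sup>2"
        by (simp add: power_mult_distrib)
      also have "\<dots> \<le> (\<Sum>j\<le>m. s i j * u j)\<^sup>2"
        unfolding u_def using i by (intro power_mono kernel_op_coord) (auto simp: m_def)
      also have "\<dots> = (\<Sum>j\<le>m. sqrt (s i j) * (sqrt (s i j) * u j))\<^sup>2"
        by (simp add: mult.assoc[symmetric] s_nonneg)
      also have "\<dots> \<le> (\<Sum>j\<le>m. (sqrt (s i j))\<^sup>2) * (\<Sum>j\<le>m. (sqrt (s i j) * u j)\<^sup>2)"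
        by (rule Cauchy_Schwarz_ineq_sum)
      also have "\<dots> = (\<Sum>j\<le>m. s i j) * (\<Sum>j\<le>m. s i j * (u j)\<^sup>2)"
        by (simp add: power_mult_distrib s_nonneg)
      also have "\<dots> \<le> r * (\<Sum>j\<le>m. s i j * (u j)\<^sup>2)"
        using tb i by (intro mult_right_mono sum_nonneg) (auto simp: tail_bound_def s_nonneg)
      finally show ?thesis .
    qed
    have "(\<Sum>i<n. (cmod (tail K f i))\<^sup>2 * pmf \<pi> i)
        = (\<Sum>i\<in>{K..<n}. (cmod (kernel_op P f i))\<^sup>2 * pmf \<pi> i)"
      by (rule sum.mono_neutral_cong_right) (auto simp: tail_def)
    also have "\<dots> \<le> (\<Sum>i\<in>{K..<n}. r * (\<Sum>j\<le>m. s i j * (u j)\<^sup>2))"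
      by (intro sum_mono row) auto
    also have "\<dots> = r * (\<Sum>j\<le>m. (\<Sum>i\<in>{K..<n}. s i j) * (u j)\<^sup>2)"
      unfolding sum_distrib_left sum_distrib_right by (subst sum.swap) simp
    also have "\<dots> \<le> r * (\<Sum>j\<le>m. r * (u j)\<^sup>2)"
      using tb r by (intro mult_left_mono sum_mono mult_right_mono) (auto simp: tail_bound_def)
    also have "\<dots> = r\<^sup>2 * (\<Sum>j<Suc m. (cmod (f j))\<^sup>2 * pmf \<pi> j)"
      unfolding lessThan_Suc_atMost
      by (simp add: sum_distrib_left[symmetric] power2_eq_square[of r] u_def power_mult_distrib)
    also have "\<dots> \<le> r\<^sup>2 * (l2_norm \<pi> f)\<^sup>2"
      by (intro mult_left_mono l2_partial_le f) auto
    finally show ?thesis by (simp add: power_mult_distrib)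
  qed
  from l2I[OF this] show "tail K f \<in> l2_space \<pi>" "l2_norm \<pi> (tail K f) \<le> r * l2_norm \<pi> f"
    using r l2_norm_nonneg[OF f] by auto
qed

end

section \<open>Strict contraction on mean-zero functions\<close>

lemma kernel_pow_Suc: "kernel_pow P (Suc n) i = bind_pmf (kernel_pow P n i) P"
  by (simp add: kernel_pow_def)

lemma kernel_pow_trans:
  assumes "j \<in> set_pmf (kernel_pow P n i)" "k \<in> set_pmf (kernel_pow P m j)"
  shows "k \<in> set_pmf (kernel_pow P (m + n) i)"
  using assms(2)
proof (induction m arbitrary: k)
  case 0
  then show ?case using assms(1) by (simp add: kernel_pow_def)
qed (auto simp: kernel_pow_Suc)

text \<open>
  A path of odd length is corrected by a loop of odd length, which exists because \<open>2\<close> does not divide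
  the greatest common divisor of the return times.
\<close>

lemma even_path:
  assumes "irreducible_kernel P" "aperiodic_kernel P"
  shows "\<exists>m. j \<in> set_pmf (kernel_pow P (2 * m) i)"
proof -
  obtain n where n: "j \<in> set_pmf (kernel_pow P n i)"
    using assms(1) unfolding irreducible_kernel_def by (meson pmf_positive_iff)
  show ?thesis
  proof (cases "even n")
    case True
    then show ?thesis using n by auto
  next
    case False
    have "\<not> 2 dvd Gcd {n. n \<ge> 1 \<and> pmf (kernel_pow P n j) j > 0}"
      using assms(2) by (simp add: aperiodic_kernel_def)
    then obtain q where "odd q" "j \<in> set_pmf (kernel_pow P q j)"
      by (auto simp: dvd_Gcd_iff pmf_positive_iff)
    then have "j \<in> set_pmf (kernel_pow P (q + n) i)" "even (q + n)"
      using kernel_pow_trans[OF n] False by auto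
    then show ?thesis by (metis evenE)
  qed
qed

context reversible_band_kernel
begin

definition common_predecessor :: "(nat \<times> nat) set" where
  "common_predecessor = {(a, b). \<exists>k. pmf (P k) a > 0 \<and> pmf (P k) b > 0}"

text \<open>
  Two steps \<open>l\<close>, \<open>k\<close>, \<open>j\<close> of the chain make \<open>l\<close> and \<open>j\<close> successors of \<open>k\<close>, since reversibility
  lets the first step be walked backwards.
\<close>

lemma connected_common_predecessor:
  assumes "irreducible_kernel P" "aperiodic_kernel P"
  shows "(i, j) \<in> common_predecessor\<^sup>*"
proof -
  have "(i, j) \<in> common_predecessor\<^sup>*" if "j \<in> set_pmf (kernel_pow P (2 * m) i)" for m
    using that
  proof (induction m arbitrary: j)
    case 0
    then show ?case by (simp add: kernel_pow_def)
  next
    case (Suc m)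
    then obtain l k where l: "l \<in> set_pmf (kernel_pow P (2 * m) i)"
      and k: "k \<in> set_pmf (P l)" "j \<in> set_pmf (P k)"
      by (auto simp: kernel_pow_Suc)
    have "(l, j) \<in> common_predecessor"
      using k positive_sym[of l k] by (auto simp: common_predecessor_def pmf_positive_iff)
    with Suc.IH[OF l] show ?case by (rule rtrancl_into_rtrancl)
  qed
  then show ?thesis using even_path[OF assms] by blast
qed

definition defect :: "(nat \<Rightarrow> complex) \<Rightarrow> real" where
  "defect f = (l2_norm \<pi> f)\<^sup>2 - (l2_norm \<pi> (kernel_op P f))\<^sup>2"

lemma defect_nonneg: "f \<in> l2_space \<pi> \<Longrightarrow> defect f \<ge> 0"
  using l2_defect(2)[of f 0 0 0] by (simp add: defect_def)

lemma oscillation_le_defect: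
  assumes "(i, j) \<in> common_predecessor\<^sup>*"
  shows "\<exists>C\<ge>0. \<forall>f\<in>l2_space \<pi>. cmod (f i - f j) \<le> C * sqrt (defect f)"
  using assms
proof (induction rule: rtrancl_induct)
  case base
  then show ?case using defect_nonneg by (intro exI[of _ 0]) auto
next
  case (step a b)
  then obtain C where C: "C \<ge> 0"
    "\<And>f. f \<in> l2_space \<pi> \<Longrightarrow> cmod (f i - f a) \<le> C * sqrt (defect f)" by blast
  obtain k where k: "pmf (P k) a > 0" "pmf (P k) b > 0"
    using step(2) by (auto simp: common_predecessor_def)
  define c where "c = pmf \<pi> k * (pmf (P k) a * pmf (P k) b)"
  have c: "c > 0" using k pos[of k] by (simp add: c_def)
  have "cmod (f i - f b) \<le> (C + 1 / sqrt c) * sqrt (defect f)" if f: "f \<in> l2_space \<pi>" for f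
  proof -
    have "c * (cmod (f a - f b))\<^sup>2 \<le> defect f"
      using l2_defect(2)[OF f, of k a b] by (simp add: defect_def c_def mult_ac)
    then have "sqrt ((cmod (f a - f b))\<^sup>2) \<le> sqrt (defect f / c)"
      using c by (intro real_sqrt_le_mono) (simp add: le_divide_eq mult.commute)
    then have "cmod (f a - f b) \<le> 1 / sqrt c * sqrt (defect f)"
      by (simp add: real_sqrt_divide)
    then show ?thesis
      using C(2)[OF f] norm_triangle_ineq[of "f i - f a" "f a - f b"] by (simp add: distrib_right)
  qed
  then show ?case using C c by (intro exI[of _ "C + 1 / sqrt c"]) auto
qed

text \<open>
  Cauchy-Schwarz; the mass of \<open>I\<close> is kept since it is small when \<open>I\<close> lies far out.
\<close>

lemma l2_L1_partial:
  assumes f: "f \<in> l2_space \<pi>" and I: "finite I"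
  shows "(\<Sum>i\<in>I. cmod (f i) * pmf \<pi> i) \<le> sqrt (\<Sum>i\<in>I. pmf \<pi> i) * l2_norm \<pi> f"
proof -
  obtain n where n: "I \<subseteq> {..<n}" using I by (metis finite_nat_iff_bounded)
  have "(\<Sum>i\<in>I. cmod (f i) * pmf \<pi> i)\<^sup>2 = (\<Sum>i\<in>I. sqrt (pmf \<pi> i) * (sqrt (pmf \<pi> i) * cmod (f i)))\<^sup>2"
    by (simp only: mult.assoc[symmetric] real_sqrt_mult_self abs_of_nonneg[OF pmf_nonneg])
      (simp only: mult.commute)
  also have "\<dots> \<le> (\<Sum>i\<in>I. (sqrt (pmf \<pi> i))\<^sup>2) * (\<Sum>i\<in>I. (sqrt (pmf \<pi> i) * cmod (f i))\<^sup>2)"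
    by (rule Cauchy_Schwarz_ineq_sum)
  also have "\<dots> = (\<Sum>i\<in>I. pmf \<pi> i) * (\<Sum>i\<in>I. (cmod (f i))\<^sup>2 * pmf \<pi> i)"
    by (simp add: power_mult_distrib mult.commute)
  also have "\<dots> \<le> (\<Sum>i\<in>I. pmf \<pi> i) * (\<Sum>i<n. (cmod (f i))\<^sup>2 * pmf \<pi> i)"
    using n by (intro mult_left_mono sum_mono2 sum_nonneg) auto
  also have "\<dots> \<le> (\<Sum>i\<in>I. pmf \<pi> i) * (l2_norm \<pi> f)\<^sup>2"
    by (intro mult_left_mono l2_partial_le f sum_nonneg) auto
  also have "\<dots> = (sqrt (\<Sum>i\<in>I. pmf \<pi> i) * l2_norm \<pi> f)\<^sup>2"
    by (simp add: power_mult_distrib sum_nonneg)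
  finally show ?thesis
    by (rule power2_le_imp_le) (intro mult_nonneg_nonneg l2_norm_nonneg f real_sqrt_ge_zero sum_nonneg, auto)
qed

definition L1 :: "(nat \<Rightarrow> complex) \<Rightarrow> bool" where
  "L1 f \<longleftrightarrow> summable (\<lambda>i. cmod (f i) * pmf \<pi> i)"

lemma L1_summable: "L1 f \<Longrightarrow> summable (\<lambda>i. f i * complex_of_real (pmf \<pi> i))"
  unfolding L1_def by (rule summable_norm_cancel) (simp add: norm_mult)

lemma L1_const: "L1 (\<lambda>i. c)"
  unfolding L1_def by (intro summable_mult summable_pmf_nat)

lemma mean_const: "mean \<pi> (\<lambda>i. c) = c"
proof -
  have "(\<Sum>i. complex_of_real (pmf \<pi> i)) = complex_of_real (\<Sum>i. pmf \<pi> i)"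
    by (rule suminf_of_real[symmetric, OF summable_pmf_nat])
  moreover have "summable (\<lambda>i. complex_of_real (pmf \<pi> i))"
    using summable_pmf_nat by (simp add: summable_of_real)
  ultimately show ?thesis
    unfolding mean_def by (simp add: suminf_mult suminf_pmf_nat)
qed

lemma mean_diff: "L1 f \<Longrightarrow> L1 g \<Longrightarrow> mean \<pi> (\<lambda>i. f i - g i) = mean \<pi> f - mean \<pi> g"
  unfolding mean_def using suminf_diff[OF L1_summable L1_summable, of f g] by (simp add: algebra_simps)

lemma mean_add: "L1 f \<Longrightarrow> L1 g \<Longrightarrow> mean \<pi> (\<lambda>i. f i + g i) = mean \<pi> f + mean \<pi> g"
  unfolding mean_def using suminf_add[OF L1_summable L1_summable, of f g] by (simp add: algebra_simps)

lemma norm_mean_le: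
  assumes "\<And>n. (\<Sum>i<n. cmod (f i) * pmf \<pi> i) \<le> B"
  shows "L1 f" "cmod (mean \<pi> f) \<le> B"
proof -
  show L1: "L1 f" unfolding L1_def by (rule summableI_nonneg_bounded[OF _ assms]) auto
  have "cmod (mean \<pi> f) \<le> (\<Sum>i. cmod (f i) * pmf \<pi> i)"
    unfolding mean_def using summable_norm[of "\<lambda>i. f i * complex_of_real (pmf \<pi> i)"] L1
    by (simp add: norm_mult L1_def)
  also have "\<dots> \<le> B" using L1 assms unfolding L1_def by (rule suminf_le_const)
  finally show "cmod (mean \<pi> f) \<le> B" .
qed

lemma l2_mean:
  assumes f: "f \<in> l2_space \<pi>"
  shows "L1 f" "cmod (mean \<pi> f) \<le> l2_norm \<pi> f"
proof -
  have "(\<Sum>i<n. cmod (f i) * pmf \<pi> i) \<le> l2_norm \<pi> f" for n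
  proof -
    have "sqrt (\<Sum>i<n. pmf \<pi> i) * l2_norm \<pi> f \<le> 1 * l2_norm \<pi> f"
      by (intro mult_right_mono l2_norm_nonneg f) (simp add: sum_pmf_le_1)
    then show ?thesis using l2_L1_partial[OF f, of "{..<n}"] by simp
  qed
  from norm_mean_le[OF this] show "L1 f" "cmod (mean \<pi> f) \<le> l2_norm \<pi> f" by auto
qed

text \<open>
  Truncated double sums: by reversibility the weight of \<open>f j\<close> in the sum over the rows below
  \<open>n + L\<close> is \<open>\<pi>(j)\<close> times the partial row sum \<open>c j\<close>, which equals \<open>1\<close> for \<open>j < n\<close>.  The two partial
  sums differ by boundary terms only, with indices between \<open>n\<close> and \<open>n + 2 L\<close>.
\<close>

lemma mean_kernel_op:
  assumes "L1 f"
  shows "mean \<pi> (kernel_op P f) = mean \<pi> f"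
proof -
  define g where "g i = cmod (f i) * pmf \<pi> i" for i
  define S where "S n = (\<Sum>i<n. kernel_op P f i * complex_of_real (pmf \<pi> i))" for n
  define T where "T n = (\<Sum>i<n. f i * complex_of_real (pmf \<pi> i))" for n
  have T: "T \<longlonglongrightarrow> mean \<pi> f"
    unfolding T_def mean_def using L1_summable[OF assms] by (rule summable_LIMSEQ)
  have diff: "cmod (S (n + L) - T n) \<le> (\<Sum>i<n + (2 * L + 1). g i) - (\<Sum>i<n. g i)" for n
  proof -
    define m where "m = n + 2 * L"
    define c where "c j = (\<Sum>i<n + L. pmf (P j) i)" for j
    have c: "0 \<le> c j" "c j \<le> 1" for j by (simp_all add: c_def sum_nonneg sum_pmf_le_1)
    have c1: "c j = 1" if "j < n" for j
      unfolding c_def using that row_sum[of j "n + L - 1"] lessThan_Suc_atMost[of "n + L - 1"] by simp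
    have "S (n + L) = (\<Sum>i<n + L. (\<Sum>j\<le>m. of_real (pmf (P i) j) * f j) * of_real (pmf \<pi> i))"
      unfolding S_def by (intro sum.cong refl arg_cong2[of _ _ _ _ "(*)"] kernel_op_eq) (simp add: m_def)
    also have "\<dots> = (\<Sum>j\<le>m. \<Sum>i<n + L. f j * of_real (pmf \<pi> i * pmf (P i) j))"
      unfolding sum_distrib_right by (subst sum.swap) (simp add: mult_ac)
    also have "\<dots> = (\<Sum>j\<le>m. \<Sum>i<n + L. f j * of_real (pmf \<pi> j) * of_real (pmf (P j) i))"
      by (intro sum.cong refl) (metis reversible mult.assoc of_real_mult)
    also have "\<dots> = (\<Sum>j\<le>m. f j * of_real (pmf \<pi> j) * of_real (c j))"
      unfolding c_def of_real_sum sum_distrib_left ..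
    finally have S: "S (n + L) = (\<Sum>j<Suc m. f j * of_real (pmf \<pi> j) * of_real (c j))"
      by (simp only: lessThan_Suc_atMost)
    have split: "(\<Sum>j<Suc m. h j) = (\<Sum>j<n. h j) + (\<Sum>j\<in>{n..<Suc m}. h j)" for h :: "nat \<Rightarrow> 'b::comm_monoid_add"
      unfolding lessThan_atLeast0 by (intro sum.atLeastLessThan_concat[symmetric]) (auto simp: m_def)
    have "(\<Sum>j<n. f j * of_real (pmf \<pi> j) * of_real (c j)) = T n"
      unfolding T_def by (intro sum.cong refl) (simp add: c1)
    then have "S (n + L) - T n = (\<Sum>j\<in>{n..<Suc m}. f j * of_real (pmf \<pi> j) * of_real (c j))"
      unfolding S split by simp
    also have "cmod \<dots> \<le> (\<Sum>j\<in>{n..<Suc m}. g j)"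
      using c by (intro sum_norm_le) (auto simp: g_def norm_mult intro!: mult_left_le)
    also have "\<dots> = (\<Sum>j<Suc m. g j) - (\<Sum>j<n. g j)" unfolding split by simp
    finally show ?thesis by (simp add: m_def)
  qed
  have g: "(\<lambda>n. \<Sum>i<n. g i) \<longlonglongrightarrow> suminf g"
    using assms unfolding L1_def g_def by (rule summable_LIMSEQ)
  have "(\<lambda>n. (\<Sum>i<n + (2 * L + 1). g i) - (\<Sum>i<n. g i)) \<longlonglongrightarrow> suminf g - suminf g"
    using LIMSEQ_ignore_initial_segment[OF g, of "2 * L + 1"] g by (rule tendsto_diff)
  then have "(\<lambda>n. S (n + L) - T n) \<longlonglongrightarrow> 0"
    by (intro Lim_null_comparison[OF always_eventually[OF allI[OF diff]]]) simp
  from tendsto_add[OF this T] have "(\<lambda>n. S (n + L)) \<longlonglongrightarrow> mean \<pi> f" by simp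
  then have "S \<longlonglongrightarrow> mean \<pi> f" by (rule LIMSEQ_offset)
  then show ?thesis
    unfolding S_def mean_def[of \<pi> "kernel_op P f"] by (intro sums_unique[symmetric]) (simp add: sums_def)
qed

text \<open>
  Write \<open>f j\<close> times the mass of \<open>{..<k}\<close> as the sum over \<open>i < k\<close> of \<open>\<pi>(i) (f j - f i)\<close> and \<open>\<pi>(i) f i\<close>.
  The first part is an oscillation, controlled by the defect.  The second part is minus the
  integral of \<open>f\<close> over the complement of \<open>{..<k}\<close>, as \<open>f\<close> has mean zero, and this complement has
  small mass.
\<close>

lemma small_of_small_defect:
  assumes "irreducible_kernel P" "aperiodic_kernel P" and \<eta>: "\<eta> > 0"
  shows "\<exists>\<delta>>0. \<forall>f\<in>l2_space \<pi>. mean \<pi> f = 0 \<longrightarrow> defect f \<le> \<delta> * (l2_norm \<pi> f)\<^sup>2 \<longrightarrow>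
    (\<forall>j\<le>m. cmod (f j) \<le> \<eta> * l2_norm \<pi> f)"
proof -
  have "\<forall>i j. \<exists>C\<ge>0. \<forall>f\<in>l2_space \<pi>. cmod (f i - f j) \<le> C * sqrt (defect f)"
    using oscillation_le_defect[OF connected_common_predecessor[OF assms(1,2)]] by blast
  then obtain c where c: "\<And>i j. c i j \<ge> 0"
    "\<And>i j f. f \<in> l2_space \<pi> \<Longrightarrow> cmod (f i - f j) \<le> c i j * sqrt (defect f)" by metis
  define G where "G k = (\<Sum>i<k. pmf \<pi> i)" for k
  have "G \<longlonglongrightarrow> 1"
    unfolding G_def using summable_LIMSEQ[OF summable_pmf_nat[of \<pi>]] by (simp add: suminf_pmf_nat)
  then have "eventually (\<lambda>k. G k > max (1/2) (1 - (\<eta> / 8)\<^sup>2)) sequentially"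
    using \<eta> by (intro order_tendstoD) auto
  then obtain k where k: "G k > 1 / 2" "1 - G k < (\<eta> / 8)\<^sup>2"
    unfolding eventually_sequentially by (force simp: algebra_simps)
  define C where "C = (\<Sum>i<k. \<Sum>j\<le>m. c j i)"
  have C: "C \<ge> 0" unfolding C_def by (intro sum_nonneg c)
  have cC: "c j i \<le> C" if "i < k" "j \<le> m" for i j
  proof -
    have "c j i \<le> (\<Sum>j\<le>m. c j i)" using that c by (intro member_le_sum) auto
    also have "\<dots> \<le> C" unfolding C_def using that c by (intro member_le_sum[of i]) (auto intro: sum_nonneg)
    finally show ?thesis .
  qed
  \<comment> \<open>oscillations are at most \<open>C\<close> times the square root of the defect, so \<open>d\<^sup>2\<close> is the fraction to allow\<close>
  define d where "d = \<eta> / (8 * (C + 1))"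
  have d: "d > 0" "C * d \<le> \<eta> / 8" using C \<eta> by (auto simp: d_def field_simps)
  show ?thesis
  proof (intro exI[of _ "d\<^sup>2"] conjI ballI impI allI)
    show "d\<^sup>2 > 0" using d by simp
    fix f j assume f: "f \<in> l2_space \<pi>" and mean0: "mean \<pi> f = 0"
      and def: "defect f \<le> d\<^sup>2 * (l2_norm \<pi> f)\<^sup>2" and j: "j \<le> m"
    define x where "x = l2_norm \<pi> f"
    have x: "x \<ge> 0" unfolding x_def by (rule l2_norm_nonneg[OF f])
    have "sqrt (defect f) \<le> sqrt ((d * x)\<^sup>2)"
      using def by (intro real_sqrt_le_mono) (simp add: power_mult_distrib x_def)
    then have sd: "sqrt (defect f) \<le> d * x" using d x by simp
    have "cmod (\<Sum>i<k. of_real (pmf \<pi> i) * (f j - f i)) \<le> (\<Sum>i<k. pmf \<pi> i * (C * (d * x)))"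
    proof (intro sum_norm_le)
      fix i assume i: "i \<in> {..<k}"
      have "cmod (f j - f i) \<le> c j i * sqrt (defect f)" by (rule c(2)[OF f])
      also have "\<dots> \<le> C * (d * x)"
        using i j by (intro mult_mono cC sd) (auto simp: C defect_nonneg[OF f])
      finally show "cmod (of_real (pmf \<pi> i) * (f j - f i)) \<le> pmf \<pi> i * (C * (d * x))"
        by (simp add: norm_mult mult_left_mono)
    qed
    also have "\<dots> = G k * (C * d * x)"
      unfolding G_def by (simp only: sum_distrib_right mult.assoc)
    also have "\<dots> \<le> 1 * (\<eta> / 8 * x)"
      using d C x sum_pmf_le_1[of "{..<k}" \<pi>] by (intro mult_mono mult_right_mono) (auto simp: G_def)
    finally have osc: "cmod (\<Sum>i<k. of_real (pmf \<pi> i) * (f j - f i)) \<le> \<eta> / 8 * x" by simp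
    have tail: "cmod (\<Sum>i<k. f i * of_real (pmf \<pi> i)) \<le> \<eta> / 8 * x"
    proof -
      have "(\<lambda>n. cmod (\<Sum>i<n. f i * of_real (pmf \<pi> i)) + \<eta> / 8 * x) \<longlonglongrightarrow> cmod 0 + \<eta> / 8 * x"
        using summable_LIMSEQ[OF L1_summable[OF l2_mean(1)[OF f]]] mean0 unfolding mean_def
        by (intro tendsto_intros) simp
      moreover have "eventually (\<lambda>n. cmod (\<Sum>i<k. f i * of_real (pmf \<pi> i))
          \<le> cmod (\<Sum>i<n. f i * of_real (pmf \<pi> i)) + \<eta> / 8 * x) sequentially"
        using eventually_ge_at_top[of k]
      proof eventually_elim
        case (elim n)
        have split: "(\<Sum>i<n. h i) = (\<Sum>i<k. h i) + (\<Sum>i\<in>{k..<n}. h i)" for h :: "nat \<Rightarrow> 'b::comm_monoid_add"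
          unfolding lessThan_atLeast0 using elim by (intro sum.atLeastLessThan_concat[symmetric]) auto
        have "(\<Sum>i\<in>{k..<n}. pmf \<pi> i) \<le> (\<eta> / 8)\<^sup>2"
          using split[of "pmf \<pi>"] sum_pmf_le_1[of "{..<n}" \<pi>] k(2) by (simp add: G_def)
        then have "sqrt (\<Sum>i\<in>{k..<n}. pmf \<pi> i) \<le> \<eta> / 8"
          using \<eta> by (metis divide_pos_pos order_less_imp_le real_sqrt_le_mono real_sqrt_unique zero_less_numeral)
        then have "sqrt (\<Sum>i\<in>{k..<n}. pmf \<pi> i) * x \<le> \<eta> / 8 * x" using x by (rule mult_right_mono)
        moreover have "cmod (\<Sum>i\<in>{k..<n}. f i * of_real (pmf \<pi> i)) \<le> (\<Sum>i\<in>{k..<n}. cmod (f i) * pmf \<pi> i)"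
          by (intro sum_norm_le) (simp add: norm_mult)
        ultimately have "cmod (\<Sum>i\<in>{k..<n}. f i * of_real (pmf \<pi> i)) \<le> \<eta> / 8 * x"
          using l2_L1_partial[OF f, of "{k..<n}"] by (simp add: x_def)
        then show ?case
          using norm_triangle_ineq4[of "\<Sum>i<n. f i * of_real (pmf \<pi> i)"
              "\<Sum>i\<in>{k..<n}. f i * of_real (pmf \<pi> i)"]
          unfolding split[of "\<lambda>i. f i * of_real (pmf \<pi> i)"] add_diff_cancel_right' by linarith
      qed
      ultimately show ?thesis by (intro tendsto_lowerbound) auto
    qed
    have "of_real (G k) * f j = (\<Sum>i<k. of_real (pmf \<pi> i) * (f j - f i)) + (\<Sum>i<k. f i * of_real (pmf \<pi> i))"
      unfolding G_def of_real_sum sum_distrib_right sum.distrib[symmetric]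
      by (intro sum.cong refl) (simp add: right_diff_distrib)
    then have "cmod (of_real (G k) * f j) \<le> \<eta> / 8 * x + \<eta> / 8 * x"
      using norm_triangle_le[OF add_mono[OF osc tail]] by simp
    then have "G k * cmod (f j) \<le> \<eta> / 4 * x"
      using k(1) by (simp add: norm_mult)
    moreover have "1 / 2 * cmod (f j) \<le> G k * cmod (f j)" using k(1) by (intro mult_right_mono) auto
    ultimately have "cmod (f j) \<le> \<eta> / 2 * x" by simp
    also have "\<dots> \<le> \<eta> * x" using x \<eta> by (simp add: mult_right_mono)
    finally show "cmod (f j) \<le> \<eta> * l2_norm \<pi> f" by (simp add: x_def)
  qed
qed

text \<open>
  If the defect of \<open>f\<close> is a fixed fraction of \<open>\<parallel>f\<parallel>\<^sup>2\<close>, contraction is immediate.  Otherwise \<open>f\<close> is small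
  on all columns that meet the rows below \<open>K\<close>, so \<open>head K f\<close> contributes at most \<open>(1 - r) / 2\<close> to
  the \<open>r\<close> coming from \<open>tail K f\<close>.
\<close>

lemma l2_strict_contraction:
  assumes "irreducible_kernel P" "aperiodic_kernel P" and tb: "tail_bound K r" and r: "r < 1"
  shows "\<exists>\<rho>\<in>{0<..<1}. \<forall>f\<in>l2_space \<pi>. mean \<pi> f = 0 \<longrightarrow> l2_norm \<pi> (kernel_op P f) \<le> \<rho> * l2_norm \<pi> f"
proof -
  note r0 = tail_bound_nonneg[OF tb]
  \<comment> \<open>each of the \<open>K\<close> rows of the head contributes at most \<open>\<eta>\<close>, together at most half of \<open>1 - r\<close>\<close>
  define \<eta> where "\<eta> = (1 - r) / (2 * (real K + 1))"
  have \<eta>: "\<eta> > 0" using r by (simp add: \<eta>_def)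
  have \<eta>K: "real K * \<eta> \<le> (1 - r) / 2" using r by (simp add: \<eta>_def field_simps)
  obtain \<delta> where \<delta>: "\<delta> > 0"
    "\<And>f j. f \<in> l2_space \<pi> \<Longrightarrow> mean \<pi> f = 0 \<Longrightarrow> defect f \<le> \<delta> * (l2_norm \<pi> f)\<^sup>2 \<Longrightarrow> j \<le> K + L \<Longrightarrow>
      cmod (f j) \<le> \<eta> * l2_norm \<pi> f"
    using small_of_small_defect[OF assms(1,2) \<eta>, of "K + L"] by blast
  define e where "e = min \<delta> (1 / 2)"
  have e: "0 < e" "e \<le> \<delta>" "e < 1" using \<delta> by (auto simp: e_def)
  define \<rho> where "\<rho> = max (sqrt (1 - e)) ((1 + r) / 2)"
  have \<rho>: "0 < \<rho>" "\<rho> < 1" using e r r0 by (auto simp: \<rho>_def less_max_iff_disj)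
  have "l2_norm \<pi> (kernel_op P f) \<le> \<rho> * l2_norm \<pi> f" if f: "f \<in> l2_space \<pi>" "mean \<pi> f = 0" for f
  proof -
    define x where "x = l2_norm \<pi> f"
    have x: "x \<ge> 0" unfolding x_def by (rule l2_norm_nonneg[OF f(1)])
    show ?thesis
    proof (cases "defect f \<le> \<delta> * x\<^sup>2")
      case True
      have coord: "cmod (kernel_op P f i) \<le> \<eta> * x" if "i < K" for i
      proof -
        have "cmod (kernel_op P f i) \<le> (\<Sum>j\<le>K + L. pmf (P i) j * (\<eta> * x))"
          using that \<delta>(2)[OF f] True unfolding kernel_op_eq[of i "K + L", OF that[THEN less_imp_le, THEN add_right_mono]]
          by (intro sum_norm_le) (auto simp: norm_mult x_def intro!: mult_left_mono)
        also have "\<dots> = \<eta> * x"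
          using row_sum[of i "K + L"] that by (simp add: sum_distrib_right[symmetric])
        finally show ?thesis .
      qed
      have "l2_norm \<pi> (head K f) \<le> (\<Sum>i<K. cmod (head K f i) * sqrt (pmf \<pi> i))"
        by (rule l2.fin_supp_nrm) (rule head_supp)
      also have "\<dots> \<le> (\<Sum>i<K. \<eta> * x * 1)"
        using coord \<eta> x by (intro sum_mono mult_mono) (auto simp: head_def pmf_le_1)
      also have "\<dots> = real K * \<eta> * x" by simp
      also have "\<dots> \<le> (1 - r) / 2 * x" using \<eta>K x by (rule mult_right_mono)
      finally have h: "l2_norm \<pi> (head K f) \<le> (1 - r) / 2 * x" .
      have "l2_norm \<pi> (kernel_op P f) \<le> l2_norm \<pi> (tail K f) + l2_norm \<pi> (head K f)"
        unfolding kernel_op_split[of f K]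
        by (intro l2.nrm_add tail_l2[OF tb f(1)] l2.fin_supp_mem[OF head_supp])
      also have "\<dots> \<le> r * x + (1 - r) / 2 * x"
        using tail_l2(2)[OF tb f(1)] h by (simp add: x_def)
      also have "\<dots> = (1 + r) / 2 * x" by (simp add: field_simps)
      also have "\<dots> \<le> \<rho> * x" using x by (intro mult_right_mono) (auto simp: \<rho>_def)
      finally show ?thesis by (simp add: x_def)
    next
      case False
      have "e * x\<^sup>2 \<le> \<delta> * x\<^sup>2" using e by (intro mult_right_mono) auto
      then have "(l2_norm \<pi> (kernel_op P f))\<^sup>2 \<le> (1 - e) * x\<^sup>2"
        using False by (simp add: defect_def x_def algebra_simps)
      also have "\<dots> = (sqrt (1 - e) * x)\<^sup>2" using e by (simp add: power_mult_distrib)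
      finally have "l2_norm \<pi> (kernel_op P f) \<le> sqrt (1 - e) * x"
        by (rule power2_le_imp_le) (use e x in auto)
      also have "\<dots> \<le> \<rho> * x" using x by (intro mult_right_mono) (auto simp: \<rho>_def)
      finally show ?thesis by (simp add: x_def)
    qed
  qed
  then show ?thesis using \<rho> by (intro bexI[of _ \<rho>]) auto
qed

end

section \<open>Comparing the spectral gaps on the two spaces\<close>

lemma (in sequence_space) spectral_gap_at_mono:
  assumes "spectral_gap_at X nrm P \<pi> \<rho>" "0 \<le> \<rho>" "\<rho> \<le> \<sigma>"
  shows "spectral_gap_at X nrm P \<pi> \<sigma>"
proof -
  obtain C where C: "C > 0" "\<And>n f. n \<ge> 1 \<Longrightarrow> f \<in> X \<Longrightarrow> (\<lambda>i. (kernel_op P ^^ n) f i - mean \<pi> f) \<in> X"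
    "\<And>n f. n \<ge> 1 \<Longrightarrow> f \<in> X \<Longrightarrow> nrm (\<lambda>i. (kernel_op P ^^ n) f i - mean \<pi> f) \<le> C * \<rho> ^ n * nrm f"
    using assms(1) by (auto simp: spectral_gap_at_def)
  have "nrm (\<lambda>i. (kernel_op P ^^ n) f i - mean \<pi> f) \<le> C * \<sigma> ^ n * nrm f" if "n \<ge> 1" "f \<in> X" for n f
  proof -
    have "C * \<rho> ^ n * nrm f \<le> C * \<sigma> ^ n * nrm f"
      using C(1) assms(2,3) nrm_nonneg[OF that(2)]
      by (intro mult_right_mono mult_left_mono power_mono) auto
    then show ?thesis using C(3)[OF that] by linarith
  qed
  then show ?thesis using C by (auto simp: spectral_gap_at_def)
qed

text \<open>
  The inductions on the power of \<open>P\<close> start at \<open>0\<close>, where the definition of the gap is silent;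
  continuity of the mean covers this case at the price of a larger constant.
\<close>

lemma (in sequence_space) spectral_gap_at_from_0:
  assumes "spectral_gap_at X nrm P \<pi> \<rho>"
    and mean: "\<And>f. f \<in> X \<Longrightarrow> (\<lambda>i. mean \<pi> f) \<in> X" "\<And>f. f \<in> X \<Longrightarrow> nrm (\<lambda>i. mean \<pi> f) \<le> c * nrm f"
  obtains C where "C > 0"
    "\<And>n f. f \<in> X \<Longrightarrow> (\<lambda>i. (kernel_op P ^^ n) f i - mean \<pi> f) \<in> X"
    "\<And>n f. f \<in> X \<Longrightarrow> nrm (\<lambda>i. (kernel_op P ^^ n) f i - mean \<pi> f) \<le> C * \<rho> ^ n * nrm f"
proof -
  obtain C where C: "C > 0" "\<And>n f. n \<ge> 1 \<Longrightarrow> f \<in> X \<Longrightarrow> (\<lambda>i. (kernel_op P ^^ n) f i - mean \<pi> f) \<in> X"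
    "\<And>n f. n \<ge> 1 \<Longrightarrow> f \<in> X \<Longrightarrow> nrm (\<lambda>i. (kernel_op P ^^ n) f i - mean \<pi> f) \<le> C * \<rho> ^ n * nrm f"
    using assms(1) by (auto simp: spectral_gap_at_def)
  have mem: "(\<lambda>i. (kernel_op P ^^ n) f i - mean \<pi> f) \<in> X" if "f \<in> X" for n f
    using C(2)[of n f] diff_mem[OF that mean(1)[OF that]] that by (cases "n = 0") auto
  have at_0: "nrm (\<lambda>i. f i - mean \<pi> f) \<le> (1 + c) * nrm f" if "f \<in> X" for f
    using nrm_diff[OF that mean(1)[OF that]] mean(2)[OF that] by (simp add: distrib_right)
  have "nrm (\<lambda>i. (kernel_op P ^^ n) f i - mean \<pi> f) \<le> (C + \<bar>1 + c\<bar>) * \<rho> ^ n * nrm f"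
    if f: "f \<in> X" for n f
  proof (cases "n = 0")
    case True
    have "(1 + c) * nrm f \<le> (C + \<bar>1 + c\<bar>) * nrm f"
      using C(1) nrm_nonneg[OF f] by (intro mult_right_mono) auto
    then show ?thesis using at_0[OF f] True by simp
  next
    case False
    then have n: "n \<ge> 1" by simp
    have "0 \<le> nrm (\<lambda>i. (kernel_op P ^^ n) f i - mean \<pi> f)" by (rule nrm_nonneg[OF mem[OF f]])
    also have "\<dots> \<le> C * (\<rho> ^ n * nrm f)" using C(3)[OF n f] by (simp add: mult.assoc)
    finally have "\<rho> ^ n * nrm f \<ge> 0" using C(1) by (simp add: zero_le_mult_iff)
    then have "C * (\<rho> ^ n * nrm f) \<le> (C + \<bar>1 + c\<bar>) * (\<rho> ^ n * nrm f)"
      by (intro mult_right_mono) auto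
    then show ?thesis using C(3)[OF n f] by (simp add: mult.assoc)
  qed
  then show ?thesis using C(1) mem by (intro that[of "C + \<bar>1 + c\<bar>"]) auto
qed

context reversible_band_kernel
begin

definition centred :: "nat \<Rightarrow> (nat \<Rightarrow> complex) \<Rightarrow> nat \<Rightarrow> complex" where
  "centred n f = (\<lambda>i. (kernel_op P ^^ n) f i - mean \<pi> f)"

lemma spectral_gap_atI:
  assumes "C > 0" "\<And>n f. f \<in> X \<Longrightarrow> centred n f \<in> X \<and> nrm (centred n f) \<le> C * \<rho> ^ n * nrm f"
  shows "spectral_gap_at X nrm P \<pi> \<rho>"
  using assms unfolding spectral_gap_at_def centred_def by blast

lemma centred_Suc: "centred (Suc n) f = kernel_op P (centred n f)"
  using kernel_op_diff[of "(kernel_op P ^^ n) f" "\<lambda>i. mean \<pi> f"]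
  by (simp add: centred_def kernel_op_const)

lemma centred_Suc_shift: "L1 f \<Longrightarrow> centred (Suc n) f = centred n (kernel_op P f)"
  by (simp add: centred_def mean_kernel_op funpow_swap1)

lemma centred_add:
  assumes "L1 f" "L1 g"
  shows "centred n (\<lambda>i. f i + g i) = (\<lambda>i. centred n f i + centred n g i)"
proof -
  have "(kernel_op P ^^ n) (\<lambda>i. f i + g i) = (\<lambda>i. (kernel_op P ^^ n) f i + (kernel_op P ^^ n) g i)"
    by (induction n) (simp_all add: kernel_op_add)
  then show ?thesis using mean_add[OF assms] by (simp add: centred_def algebra_simps)
qed

lemma l2_const: "(\<lambda>i. c) \<in> l2_space \<pi>" "l2_norm \<pi> (\<lambda>i. c) \<le> cmod c"
proof -
  have "(\<Sum>i<n. (cmod c)\<^sup>2 * pmf \<pi> i) \<le> (cmod c)\<^sup>2" for n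
    using mult_left_mono[OF sum_pmf_le_1[of "{..<n}" \<pi>], of "(cmod c)\<^sup>2"]
    by (simp add: sum_distrib_left)
  from l2I[OF this] show "(\<lambda>i. c) \<in> l2_space \<pi>" "l2_norm \<pi> (\<lambda>i. c) \<le> cmod c" by auto
qed

lemma l2_sub_mean:
  assumes "f \<in> l2_space \<pi>"
  shows "(\<lambda>i. f i - mean \<pi> f) \<in> l2_space \<pi>" "l2_norm \<pi> (\<lambda>i. f i - mean \<pi> f) \<le> 2 * l2_norm \<pi> f"
  using l2.diff_mem[OF assms l2_const(1)] l2.nrm_diff[OF assms l2_const(1)[of "mean \<pi> f"]]
    l2_const(2)[of "mean \<pi> f"] l2_mean(2)[OF assms] by auto

lemma l2_subset_BV:
  assumes "f \<in> l2_space \<pi>"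
  shows "f \<in> BV_space (weight \<pi>)" "BV_norm (weight \<pi>) f \<le> l2_norm \<pi> f"
  using BVI[OF pos l2.coord_le[OF assms]] by auto

lemma head_l2:
  assumes f: "f \<in> BV_space (weight \<pi>)"
  shows "head K f \<in> l2_space \<pi>"
    "l2_norm \<pi> (head K f) \<le> real K * real (2 * L + 1) * BV_norm (weight \<pi>) f"
proof -
  show "head K f \<in> l2_space \<pi>" by (rule l2.fin_supp_mem[OF head_supp])
  have "l2_norm \<pi> (head K f) \<le> (\<Sum>i<K. cmod (head K f i) * sqrt (pmf \<pi> i))"
    by (rule l2.fin_supp_nrm) (rule head_supp)
  also have "\<dots> \<le> (\<Sum>i<K. real (2 * L + 1) * BV_norm (weight \<pi>) f)"
    using BV_kernel_coord[OF f s_row_sum_le] by (intro sum_mono) (simp add: head_def)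
  finally show "l2_norm \<pi> (head K f) \<le> real K * real (2 * L + 1) * BV_norm (weight \<pi>) f"
    by simp
qed

lemma spectral_gap_l2_ex:
  assumes "irreducible_kernel P" "aperiodic_kernel P" "tail_bound K r" "r < 1"
  shows "spectral_gap_l2 P \<pi>"
proof -
  obtain \<rho> where \<rho>: "\<rho> \<in> {0<..<1}"
    "\<And>f. f \<in> l2_space \<pi> \<Longrightarrow> mean \<pi> f = 0 \<Longrightarrow> l2_norm \<pi> (kernel_op P f) \<le> \<rho> * l2_norm \<pi> f"
    using l2_strict_contraction[OF assms] by blast
  have *: "centred n f \<in> l2_space \<pi> \<and> mean \<pi> (centred n f) = 0 \<and>
      l2_norm \<pi> (centred n f) \<le> 2 * \<rho> ^ n * l2_norm \<pi> f" if f: "f \<in> l2_space \<pi>" for n f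
  proof (induction n)
    case 0
    then show ?case
      using l2_sub_mean[OF f] mean_diff[OF l2_mean(1)[OF f] L1_const, of "mean \<pi> f"]
      by (simp add: centred_def mean_const)
  next
    case (Suc n)
    then have "l2_norm \<pi> (centred (Suc n) f) \<le> \<rho> * l2_norm \<pi> (centred n f)"
      unfolding centred_Suc using \<rho>(2) by blast
    also have "\<dots> \<le> \<rho> * (2 * \<rho> ^ n * l2_norm \<pi> f)"
      using Suc \<rho>(1) by (intro mult_left_mono) auto
    finally show ?case
      using Suc l2_defect(1) mean_kernel_op[OF l2_mean(1)] by (auto simp: centred_Suc)
  qed
  show ?thesis
    unfolding spectral_gap_def using \<rho>(1) * by (intro bexI[of _ \<rho>] spectral_gap_atI[of 2]) auto
qed

lemma r_ess_l2_le:
  assumes tb: "tail_bound K r"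
  shows "r_ess_l2 P \<pi> \<le> r"
proof (rule l2.ess_spectral_radius_le[OF bounded_l2 l2.compact_op_finite_rank[OF bounded_l2, of K]])
  fix f assume "f \<in> l2_space \<pi>"
  moreover have "(\<lambda>i. kernel_op P f i - (if i < K then kernel_op P f i else 0)) = tail K f"
    by (auto simp: tail_def)
  ultimately show "l2_norm \<pi> (\<lambda>i. kernel_op P f i - (if i < K then kernel_op P f i else 0)) \<le> r * l2_norm \<pi> f"
    using tail_l2(2)[OF tb] by simp
qed (rule tail_bound_nonneg[OF tb])

lemma r_ess_V_le:
  assumes tb: "tail_bound K r"
  shows "r_ess_V P \<pi> \<le> r"
proof (rule BV.ess_spectral_radius_le[OF bounded_V BV.compact_op_finite_rank[OF bounded_V, of K]])
  fix f assume "f \<in> BV_space (weight \<pi>)"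
  moreover have "(\<lambda>i. kernel_op P f i - (if i < K then kernel_op P f i else 0)) = tail K f"
    by (auto simp: tail_def)
  ultimately show "BV_norm (weight \<pi>) (\<lambda>i. kernel_op P f i - (if i < K then kernel_op P f i else 0))
      \<le> r * BV_norm (weight \<pi>) f"
    using tail_BV(2)[OF tb] by simp
qed (rule tail_bound_nonneg[OF tb])

lemma BV_mean:
  assumes sm: "summable (\<lambda>i. sqrt (pmf \<pi> i))" and f: "f \<in> BV_space (weight \<pi>)"
  shows "L1 f" "(\<lambda>i. mean \<pi> f) \<in> BV_space (weight \<pi>)"
    "BV_norm (weight \<pi>) (\<lambda>i. mean \<pi> f) \<le> (\<Sum>i. sqrt (pmf \<pi> i)) * BV_norm (weight \<pi>) f"
proof -
  have "(\<Sum>i<n. cmod (f i) * pmf \<pi> i) \<le> (\<Sum>i. sqrt (pmf \<pi> i)) * BV_norm (weight \<pi>) f" for n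
  proof -
    have "(\<Sum>i<n. cmod (f i) * pmf \<pi> i) = (\<Sum>i<n. sqrt (pmf \<pi> i) * (cmod (f i) * sqrt (pmf \<pi> i)))"
      by (intro sum.cong refl) (simp add: mult.left_commute[of "sqrt _"])
    also have "\<dots> \<le> (\<Sum>i<n. sqrt (pmf \<pi> i) * BV_norm (weight \<pi>) f)"
      by (intro sum_mono mult_left_mono BV.coord_le f) auto
    also have "\<dots> = (\<Sum>i<n. sqrt (pmf \<pi> i)) * BV_norm (weight \<pi>) f" by (simp add: sum_distrib_right)
    also have "\<dots> \<le> (\<Sum>i. sqrt (pmf \<pi> i)) * BV_norm (weight \<pi>) f"
      by (intro mult_right_mono sum_le_suminf sm BV.nrm_nonneg f) auto
    finally show ?thesis .
  qed
  note le = norm_mean_le[OF this]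
  show "L1 f" by (rule le(1))
  show "(\<lambda>i. mean \<pi> f) \<in> BV_space (weight \<pi>)"
    "BV_norm (weight \<pi>) (\<lambda>i. mean \<pi> f) \<le> (\<Sum>i. sqrt (pmf \<pi> i)) * BV_norm (weight \<pi>) f"
    using l2_subset_BV[OF l2_const(1)[of "mean \<pi> f"]] l2_const(2)[of "mean \<pi> f"] le(2) by auto
qed

text \<open>
  Uses \<open>E\<^sub>n\<^sub>+\<^sub>1 = T E\<^sub>n + H E\<^sub>n\<close>: the gap on \<open>B\<^sub>V\<close> makes \<open>H E\<^sub>n f\<close> of size \<open>\<rho> ^ n\<close>, and \<open>T\<close> contracts by
  \<open>r < \<rho>\<close> in \<open>\<ell>\<^sup>2(\<pi>)\<close>.
\<close>

lemma spectral_gap_V_imp_l2: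
  assumes sm: "summable (\<lambda>i. sqrt (pmf \<pi> i))" and tb: "tail_bound K r" and r: "r < \<rho>"
    and gap: "spectral_gap_at (BV_space (weight \<pi>)) (BV_norm (weight \<pi>)) P \<pi> \<rho>"
  shows "spectral_gap_at (l2_space \<pi>) (l2_norm \<pi>) P \<pi> \<rho>"
proof -
  have \<rho>: "\<rho> > 0" using r tail_bound_nonneg[OF tb] by simp
  obtain C where C: "C > 0"
    "\<And>n f. f \<in> BV_space (weight \<pi>) \<Longrightarrow> centred n f \<in> BV_space (weight \<pi>)"
    "\<And>n f. f \<in> BV_space (weight \<pi>) \<Longrightarrow>
      BV_norm (weight \<pi>) (centred n f) \<le> C * \<rho> ^ n * BV_norm (weight \<pi>) f"
    using BV.spectral_gap_at_from_0[OF gap BV_mean(2,3)[OF sm]] unfolding centred_def by metis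
  define B where "B = real K * real (2 * L + 1)"
  \<comment> \<open>D solves \<open>r D + B C \<le> \<rho> D\<close>, so that a bound \<open>D \<rho> ^ n\<close> reproduces itself\<close>
  define D where "D = max 2 (B * C / (\<rho> - r))"
  have B: "B \<ge> 0" by (simp add: B_def)
  have D: "D \<ge> 2" by (simp add: D_def)
  have "B * C / (\<rho> - r) \<le> D" by (simp add: D_def)
  then have DB: "r * D + B * C \<le> \<rho> * D" using r by (simp add: field_simps)
  have *: "centred n f \<in> l2_space \<pi> \<and> l2_norm \<pi> (centred n f) \<le> D * \<rho> ^ n * l2_norm \<pi> f"
    if f: "f \<in> l2_space \<pi>" for n f
  proof (induction n)
    case 0
    have "2 * l2_norm \<pi> f \<le> D * l2_norm \<pi> f" by (intro mult_right_mono D l2_norm_nonneg f)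
    then show ?case using l2_sub_mean[OF f] by (simp add: centred_def)
  next
    case (Suc n)
    define g where "g = centred n f"
    define x where "x = \<rho> ^ n * l2_norm \<pi> f"
    have x: "x \<ge> 0" using \<rho> l2_norm_nonneg[OF f] by (simp add: x_def)
    have g: "g \<in> l2_space \<pi>" "l2_norm \<pi> g \<le> D * x" using Suc by (auto simp: g_def x_def mult.assoc)
    have gV: "BV_norm (weight \<pi>) g \<le> C * x"
    proof -
      have "BV_norm (weight \<pi>) g \<le> C * \<rho> ^ n * BV_norm (weight \<pi>) f"
        unfolding g_def by (rule C(3)[OF l2_subset_BV(1)[OF f]])
      also have "\<dots> \<le> C * \<rho> ^ n * l2_norm \<pi> f"
        using C(1) \<rho> by (intro mult_left_mono l2_subset_BV f) auto
      finally show ?thesis by (simp add: x_def mult.assoc)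
    qed
    have "l2_norm \<pi> (kernel_op P g) \<le> l2_norm \<pi> (tail K g) + l2_norm \<pi> (head K g)"
      unfolding kernel_op_split[of g K]
      by (intro l2.nrm_add tail_l2[OF tb g(1)] l2.fin_supp_mem[OF head_supp])
    also have "\<dots> \<le> r * l2_norm \<pi> g + B * BV_norm (weight \<pi>) g"
      using tail_l2(2)[OF tb g(1)] head_l2(2)[OF l2_subset_BV(1)[OF g(1)], of K]
      by (simp add: B_def)
    also have "\<dots> \<le> r * (D * x) + B * (C * x)"
      using g gV B tail_bound_nonneg[OF tb] by (intro add_mono mult_left_mono) auto
    also have "\<dots> = (r * D + B * C) * x" by (simp add: algebra_simps)
    also have "\<dots> \<le> (\<rho> * D) * x" by (intro mult_right_mono DB x)
    finally show ?case using l2_defect(1)[OF g(1)] by (simp add: centred_Suc g_def x_def mult_ac)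
  qed
  show ?thesis by (rule spectral_gap_atI[of D]) (use D * in auto)
qed

text \<open>
  Uses \<open>E\<^sub>n\<^sub>+\<^sub>1 = E\<^sub>n T + E\<^sub>n H\<close>: here \<open>H f\<close> lies in \<open>\<ell>\<^sup>2(\<pi>)\<close>, where \<open>E\<^sub>n\<close> has size \<open>\<rho> ^ n\<close>, and \<open>T f\<close> is
  handled by the induction hypothesis, which therefore ranges over all \<open>f\<close>.
\<close>

lemma spectral_gap_l2_imp_V:
  assumes sm: "summable (\<lambda>i. sqrt (pmf \<pi> i))" and tb: "tail_bound K r" and r: "r < \<rho>"
    and gap: "spectral_gap_at (l2_space \<pi>) (l2_norm \<pi>) P \<pi> \<rho>"
  shows "spectral_gap_at (BV_space (weight \<pi>)) (BV_norm (weight \<pi>)) P \<pi> \<rho>"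
proof -
  have \<rho>: "\<rho> > 0" using r tail_bound_nonneg[OF tb] by simp
  have l2m: "l2_norm \<pi> (\<lambda>i. mean \<pi> f) \<le> 1 * l2_norm \<pi> f" if "f \<in> l2_space \<pi>" for f
    using l2_const(2)[of "mean \<pi> f"] l2_mean(2)[OF that] by simp
  obtain C where C: "C > 0"
    "\<And>n f. f \<in> l2_space \<pi> \<Longrightarrow> centred n f \<in> l2_space \<pi>"
    "\<And>n f. f \<in> l2_space \<pi> \<Longrightarrow> l2_norm \<pi> (centred n f) \<le> C * \<rho> ^ n * l2_norm \<pi> f"
    using l2.spectral_gap_at_from_0[OF gap l2_const(1) l2m] unfolding centred_def by metis
  define B where "B = real K * real (2 * L + 1)"
  define c where "c = 1 + (\<Sum>i. sqrt (pmf \<pi> i))"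
  \<comment> \<open>the same choice as for the converse implication, with \<open>c\<close> covering the power \<open>0\<close>\<close>
  define D where "D = max c (B * C / (\<rho> - r))"
  have B: "B \<ge> 0" by (simp add: B_def)
  have c: "c > 0" unfolding c_def by (intro add_pos_nonneg suminf_nonneg sm) auto
  have D: "D \<ge> c" by (simp add: D_def)
  have "B * C / (\<rho> - r) \<le> D" by (simp add: D_def)
  then have DB: "r * D + B * C \<le> \<rho> * D" using r by (simp add: field_simps)
  have *: "centred n f \<in> BV_space (weight \<pi>) \<and>
      BV_norm (weight \<pi>) (centred n f) \<le> D * \<rho> ^ n * BV_norm (weight \<pi>) f"
    if f: "f \<in> BV_space (weight \<pi>)" for n f
    using that
  proof (induction n arbitrary: f)
    case (0 f)
    have "c * BV_norm (weight \<pi>) f \<le> D * BV_norm (weight \<pi>) f"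
      by (intro mult_right_mono D BV.nrm_nonneg 0)
    moreover have "BV_norm (weight \<pi>) (centred 0 f) \<le> c * BV_norm (weight \<pi>) f"
      using BV.nrm_diff[OF 0 BV_mean(2)[OF sm 0]] BV_mean(3)[OF sm 0]
      by (simp add: centred_def c_def distrib_right)
    moreover have "centred 0 f \<in> BV_space (weight \<pi>)"
      using BV.diff_mem[OF 0 BV_mean(2)[OF sm 0]] by (simp add: centred_def)
    ultimately show ?case by simp
  next
    case (Suc n f)
    define x where "x = BV_norm (weight \<pi>) f"
    note tl = tail_BV[OF tb Suc.prems] and hd = head_l2[OF Suc.prems, of K]
    have eq: "centred (Suc n) f = (\<lambda>i. centred n (tail K f) i + centred n (head K f) i)"
      using centred_Suc_shift[OF BV_mean(1)[OF sm Suc.prems], of n]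
        centred_add[OF BV_mean(1)[OF sm tl(1)] l2_mean(1)[OF hd(1)], of n]
      by (simp add: kernel_op_split[of f K, symmetric])
    have T: "centred n (tail K f) \<in> BV_space (weight \<pi>)"
      "BV_norm (weight \<pi>) (centred n (tail K f)) \<le> D * \<rho> ^ n * BV_norm (weight \<pi>) (tail K f)"
      using Suc.IH[OF tl(1)] by auto
    note H = C(2)[OF hd(1), of n] C(3)[OF hd(1), of n]
    have mem: "centred (Suc n) f \<in> BV_space (weight \<pi>)"
      unfolding eq by (intro BV.add_mem T(1) l2_subset_BV(1)[OF H(1)])
    have "BV_norm (weight \<pi>) (centred (Suc n) f)
        \<le> BV_norm (weight \<pi>) (centred n (tail K f)) + BV_norm (weight \<pi>) (centred n (head K f))"
      unfolding eq by (intro BV.nrm_add T(1) l2_subset_BV(1)[OF H(1)])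
    also have "\<dots> \<le> D * \<rho> ^ n * BV_norm (weight \<pi>) (tail K f) + C * \<rho> ^ n * l2_norm \<pi> (head K f)"
      using T(2) H(2) l2_subset_BV(2)[OF H(1)] by linarith
    also have "\<dots> \<le> D * \<rho> ^ n * (r * x) + C * \<rho> ^ n * (B * x)"
      using tl(2) hd(2) D c C(1) \<rho> by (intro add_mono mult_left_mono) (auto simp: x_def B_def)
    also have "\<dots> = (r * D + B * C) * (\<rho> ^ n * x)" by (simp add: algebra_simps)
    also have "\<dots> \<le> (\<rho> * D) * (\<rho> ^ n * x)"
      using \<rho> BV.nrm_nonneg[OF Suc.prems] by (intro mult_right_mono DB) (simp add: x_def)
    finally show ?case using mem by (simp add: x_def mult_ac)
  qed
  show ?thesis by (rule spectral_gap_atI[of D]) (use D c * in auto)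
qed

end

text \<open>
  Two up-closed sets of rates that agree above \<open>\<alpha>\<close> have the same infimum as soon as one infimum
  exceeds \<open>\<alpha>\<close>.
\<close>

lemma Inf_eq_above:
  fixes A B :: "real set"
  assumes sub: "A \<subseteq> {0<..<1}" "B \<subseteq> {0<..<1}" and ne: "A \<noteq> {}" "B \<noteq> {}"
    and up: "\<And>x y. x \<in> A \<Longrightarrow> x \<le> y \<Longrightarrow> y < 1 \<Longrightarrow> y \<in> A" "\<And>x y. x \<in> B \<Longrightarrow> x \<le> y \<Longrightarrow> y < 1 \<Longrightarrow> y \<in> B"
    and agree: "\<And>x. \<alpha> < x \<Longrightarrow> x < 1 \<Longrightarrow> x \<in> A \<longleftrightarrow> x \<in> B" and \<alpha>: "\<alpha> < 1"
  shows "(Inf B \<le> \<alpha> \<longrightarrow> Inf A \<le> \<alpha>) \<and> (Inf B > \<alpha> \<longrightarrow> Inf A = Inf B)"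
proof -
  have bdd: "bdd_below A" "bdd_below B" using sub by (auto intro!: bdd_belowI[where m = 0])
  have ltA: "Inf A \<le> y" if "y \<in> A" for y using that bdd by (intro cInf_lower)
  have ltB: "Inf B \<le> y" if "y \<in> B" for y using that bdd by (intro cInf_lower)
  have memB: "y \<in> B" if "Inf B < y" "y < 1" for y
    using that ne(2) bdd(2) up(2) by (metis cInf_less_iff less_imp_le)
  show ?thesis
  proof (intro conjI impI)
    assume le: "Inf B \<le> \<alpha>"
    show "Inf A \<le> \<alpha>"
    proof (rule ccontr)
      assume "\<not> Inf A \<le> \<alpha>"
      then obtain z where z: "\<alpha> < z" "z < min (Inf A) 1" using \<alpha> dense[of \<alpha> "min (Inf A) 1"] by auto
      then have "z \<in> A" using memB[of z] agree[of z] le by auto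
      then show False using ltA[of z] z by auto
    qed
  next
    assume gt: "Inf B > \<alpha>"
    have "Inf A \<le> y" if "y \<in> B" for y
      using that agree[of y] ltA[of y] ltB[of y] gt sub by auto
    then have "Inf A \<le> Inf B" using ne by (intro cInf_greatest)
    moreover have "Inf B \<le> y" if y: "y \<in> A" for y
    proof (rule ccontr)
      assume "\<not> Inf B \<le> y"
      then obtain z where z: "max y \<alpha> < z" "z < Inf B" using gt dense[of "max y \<alpha>" "Inf B"] by auto
      obtain b where "b \<in> B" using ne by auto
      then have "z < 1" using z ltB[of b] sub by auto
      then have "z \<in> B" using up(1)[OF y, of z] agree[of z] z by auto
      then show False using ltB[of z] z by auto
    qed
    then have "Inf B \<le> Inf A" using ne by (intro cInf_greatest)
    ultimately show "Inf A = Inf B" by simp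
  qed
qed

context reversible_band_kernel
begin

lemma gap_conclusionsI:
  assumes irr: "irreducible_kernel P" "aperiodic_kernel P"
    and sm: "summable (\<lambda>i. sqrt (pmf \<pi> i))"
    and tb: "\<And>r. r > alpha0 P N \<Longrightarrow> \<exists>K. tail_bound K r" and \<alpha>: "alpha0 P N < 1"
  shows "gap_conclusions P \<pi> N"
proof -
  let ?A = "{\<rho> \<in> {0<..<1}. spectral_gap_at (l2_space \<pi>) (l2_norm \<pi>) P \<pi> \<rho>}"
  let ?B = "{\<rho> \<in> {0<..<1}. spectral_gap_at (BV_space (weight \<pi>)) (BV_norm (weight \<pi>)) P \<pi> \<rho>}"
  have agree: "x \<in> ?A \<longleftrightarrow> x \<in> ?B" if x: "alpha0 P N < x" for x
  proof -
    obtain r where r: "alpha0 P N < r" "r < x" using dense[OF x] by blast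
    obtain K where "tail_bound K r" using tb[OF r(1)] by blast
    then show ?thesis using spectral_gap_V_imp_l2[OF sm] spectral_gap_l2_imp_V[OF sm] r(2) by blast
  qed
  have up: "y \<in> ?A" if "x \<in> ?A" "x \<le> y" "y < 1" for x y
    using that l2.spectral_gap_at_mono[of P \<pi> x y] by auto
  have up': "y \<in> ?B" if "x \<in> ?B" "x \<le> y" "y < 1" for x y
    using that BV.spectral_gap_at_mono[of P \<pi> x y] by auto
  obtain r where r: "alpha0 P N < r" "r < 1" using dense[OF \<alpha>] by blast
  obtain K where K: "tail_bound K r" using tb[OF r(1)] by blast
  have l2: "spectral_gap_l2 P \<pi>" by (rule spectral_gap_l2_ex[OF irr K r(2)])
  then obtain \<rho> where \<rho>: "\<rho> \<in> ?A" by (auto simp: spectral_gap_def)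
  then have "max \<rho> r \<in> ?A" using up[of \<rho> "max \<rho> r"] r(2) by simp
  then have B: "max \<rho> r \<in> ?B" using agree[of "max \<rho> r"] r(1) by simp
  then have V: "spectral_gap_V P \<pi>" unfolding spectral_gap_def by blast
  have ess2: "r_ess_l2 P \<pi> \<le> alpha0 P N"
    using tb r_ess_l2_le by (meson dense_ge)
  have essV: "r_ess_V P \<pi> \<le> alpha0 P N"
    using tb r_ess_V_le by (meson dense_ge)
  have A_ne: "?A \<noteq> {}" and B_ne: "?B \<noteq> {}" using \<rho> B by blast+
  have "(Inf ?B \<le> alpha0 P N \<longrightarrow> Inf ?A \<le> alpha0 P N) \<and> (Inf ?B > alpha0 P N \<longrightarrow> Inf ?A = Inf ?B)"
    by (rule Inf_eq_above[OF _ _ A_ne B_ne up up' agree \<alpha>]) auto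
  then show ?thesis
    using \<alpha> l2 V bounded_l2 bounded_V ess2 essV
    unfolding gap_conclusions_def gap_rate_def by auto
qed

end

section \<open>The diagonals of the kernel\<close>

lemma pos_invariant:
  assumes "irreducible_kernel P" "invariant_pmf P \<pi>"
  shows "pmf \<pi> j > 0"
proof -
  obtain i where i: "i \<in> set_pmf \<pi>" using set_pmf_not_empty[of \<pi>] by blast
  obtain n where n: "j \<in> set_pmf (kernel_pow P n i)"
    using assms(1) unfolding irreducible_kernel_def by (meson pmf_positive_iff)
  have "set_pmf (kernel_pow P n i) \<subseteq> set_pmf \<pi>"
  proof (induction n)
    case 0
    then show ?case using i by (simp add: kernel_pow_def)
  next
    case (Suc n)
    have "set_pmf (bind_pmf \<pi> P) = set_pmf \<pi>" using assms(2) by (simp add: invariant_pmf_def)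
    then show ?case using Suc by (auto simp: kernel_pow_Suc)
  qed
  then show ?thesis using n by (auto simp: pmf_positive_iff)
qed

lemma sum_diagonals:
  assumes "i \<ge> N"
  shows "(\<Sum>m\<in>{- int N..int N}. h (nat (int i + m))) = (\<Sum>j\<in>{i - N..i + N}. h j)"
  by (rule sum.reindex_bij_witness[of _ "\<lambda>j. int j - int i" "\<lambda>m. nat (int i + m)"])
     (use assms in auto)

lemma sum_symmetric_interval:
  fixes g :: "int \<Rightarrow> 'a :: comm_monoid_add"
  shows "(\<Sum>m\<in>{- int N..int N}. g m) = g 0 + (\<Sum>m\<in>{1..int N}. g m + g (- m))"
proof -
  have "{- int N..int N} = {0} \<union> ({1..int N} \<union> uminus ` {1..int N})"
  proof (intro set_eqI iffI)
    fix m assume "m \<in> {- int N..int N}"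
    then show "m \<in> {0} \<union> ({1..int N} \<union> uminus ` {1..int N})"
      by (cases "m < 0") (auto intro!: image_eqI[of _ _ "- m"])
  qed auto
  then have "(\<Sum>m\<in>{- int N..int N}. g m)
      = g 0 + ((\<Sum>m\<in>{1..int N}. g m) + (\<Sum>m\<in>uminus ` {1..int N}. g m))"
    by (simp only:) (subst sum.union_disjoint; (subst sum.union_disjoint)?; auto)+
  also have "(\<Sum>m\<in>uminus ` {1..int N}. g m) = (\<Sum>m\<in>{1..int N}. g (- m))"
    by (subst sum.reindex) (auto simp: inj_on_def)
  finally show ?thesis by (simp add: sum.distrib)
qed

text \<open>
  Two widths occur: \<open>L\<close> bounds the band of every row, \<open>N\<close> only that of the rows from \<open>i0\<close> on, and
  \<open>\<alpha>\<^sub>0\<close> refers to \<open>N\<close>.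
\<close>

locale asymptotically_banded_kernel = reversible_band_kernel +
  fixes i0 N :: nat
  assumes far_band: "i \<ge> i0 \<Longrightarrow> \<bar>int i - int j\<bar> > int N \<Longrightarrow> pmf (P i) j = 0"
begin

definition diag :: "int \<Rightarrow> nat \<Rightarrow> real" where
  "diag m i = s i (nat (int i + m))"

lemma alpha0_eq: "alpha0 P N = (\<Sum>m\<in>{- int N..int N}. real_of_ereal (limsup (\<lambda>i. ereal (diag m i))))"
  by (simp add: alpha0_def diag_def s_def)

lemma eventually_diag_less:
  assumes "e > 0"
  shows "eventually (\<lambda>i. diag m i < real_of_ereal (limsup (\<lambda>i. ereal (diag m i))) + e) sequentially"
proof -
  let ?l = "limsup (\<lambda>i. ereal (diag m i))"
  have "?l \<le> 1" using s_le_1 by (intro Limsup_bounded always_eventually) (simp add: diag_def one_ereal_def)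
  moreover have "0 \<le> ?l"
    using s_nonneg by (intro le_Limsup always_eventually) (simp_all add: diag_def zero_ereal_def)
  ultimately obtain l where l: "?l = ereal l" by (cases ?l) auto
  have "?l < ereal (l + e)" using l assms by simp
  from Limsup_lessD[OF this] show ?thesis unfolding l by simp
qed

lemma far_row:
  assumes "i \<ge> i0" "j \<notin> {i - N..i + N}"
  shows "pmf (P i) j = 0"
  using assms by (intro far_band) auto

text \<open>
  From some row \<open>k'\<close> on, each of the \<open>2 N + 1\<close> diagonals is within \<open>e\<close> of its limit superior.
  Rows from \<open>k' + L\<close> on meet only columns from \<open>k'\<close> on, whose sums are row sums by symmetry.
\<close>

lemma tail_bound_above_alpha0:
  assumes r: "r > alpha0 P N"
  shows "\<exists>K. tail_bound K r"
proof -
  define l where "l m = real_of_ereal (limsup (\<lambda>i. ereal (diag m i)))" for m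
  define e where "e = (r - alpha0 P N) / real (2 * N + 1)"
  have e: "e > 0" using r by (simp add: e_def)
  have "eventually (\<lambda>i. \<forall>m\<in>{- int N..int N}. diag m i < l m + e) sequentially"
    unfolding l_def by (intro eventually_ball_finite ballI eventually_diag_less e) simp
  then obtain k where k: "\<And>i m. i \<ge> k \<Longrightarrow> m \<in> {- int N..int N} \<Longrightarrow> diag m i < l m + e"
    unfolding eventually_sequentially by blast
  define k' where "k' = max k (max i0 N)"
  have row: "(\<Sum>j\<in>J. s i j) \<le> r" if "i \<ge> k'" "finite J" for i J
  proof -
    have "(\<Sum>j\<in>J. s i j) = (\<Sum>j\<in>J \<inter> {i - N..i + N}. s i j)"
      using that far_row[of i] by (intro sum.mono_neutral_right) (auto simp: s_def k'_def)
    also have "\<dots> \<le> (\<Sum>j\<in>{i - N..i + N}. s i j)"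
      by (intro sum_mono2) (auto simp: s_nonneg)
    also have "\<dots> = (\<Sum>m\<in>{- int N..int N}. diag m i)"
      unfolding diag_def using that by (intro sum_diagonals[symmetric]) (simp add: k'_def)
    also have "\<dots> \<le> (\<Sum>m\<in>{- int N..int N}. l m + e)"
      using k that by (intro sum_mono less_imp_le) (auto simp: k'_def)
    also have "\<dots> = alpha0 P N + real (2 * N + 1) * e"
      by (simp add: sum.distrib alpha0_eq l_def)
    also have "\<dots> = r" by (simp add: e_def)
    finally show ?thesis .
  qed
  have "tail_bound (k' + L) r"
    unfolding tail_bound_def
  proof (intro conjI allI impI)
    fix i m assume "k' + L \<le> i"
    then show "(\<Sum>j\<le>m. s i j) \<le> r" by (intro row) auto
  next
    fix j n
    show "(\<Sum>i\<in>{k' + L..<n}. s i j) \<le> r"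
    proof (cases "j \<ge> k'")
      case True
      then show ?thesis using row[of j "{k' + L..<n}"] by (simp add: s_sym)
    next
      case False
      then have "(\<Sum>i\<in>{k' + L..<n}. s i j) = 0" by (intro sum.neutral) (auto intro!: s_band)
      then show ?thesis using row[of k' "{}"] by simp
    qed
  qed
  then show ?thesis ..
qed

lemma shift_at_top: "filterlim (\<lambda>i. nat (int i + m)) sequentially sequentially"
  unfolding filterlim_at_top
proof
  fix Z
  show "eventually (\<lambda>i. Z \<le> nat (int i + m)) sequentially"
    using eventually_ge_at_top[of "nat (int Z - m)"] by eventually_elim auto
qed

lemma diagonal_limitsD:
  assumes "diagonal_limits P N a" "m \<in> {- int N..int N}"
  shows "a m \<ge> 0" "(\<lambda>i. pmf (P i) (nat (int i + m))) \<longlonglongrightarrow> a m"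
  using assms unfolding diagonal_limits_def by auto

lemma diagonal_backwards:
  assumes "diagonal_limits P N a" "m \<in> {- int N..int N}"
  shows "(\<lambda>i. pmf (P (nat (int i + m))) i) \<longlonglongrightarrow> a (- m)"
proof -
  have "(\<lambda>i. pmf (P i) (nat (int i + - m))) \<longlonglongrightarrow> a (- m)"
    using assms(2) by (intro diagonal_limitsD(2)[OF assms(1)]) auto
  from filterlim_compose[OF this shift_at_top[of m]]
  have "(\<lambda>i. pmf (P (nat (int i + m))) (nat (int (nat (int i + m)) + - m))) \<longlonglongrightarrow> a (- m)" .
  moreover have "eventually (\<lambda>i. pmf (P (nat (int i + m))) (nat (int (nat (int i + m)) + - m))
      = pmf (P (nat (int i + m))) i) sequentially"
    using eventually_ge_at_top[of "nat (- m)"] by eventually_elim auto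
  ultimately show ?thesis by (rule Lim_transform_eventually)
qed

lemma diag_limit:
  assumes "diagonal_limits P N a" "m \<in> {- int N..int N}"
  shows "diag m \<longlonglongrightarrow> sqrt (a m * a (- m))"
  unfolding diag_def s_def using assms diagonal_backwards[OF assms]
  by (intro tendsto_intros) (auto simp: diagonal_limits_def)

lemma alpha0_limit:
  assumes "diagonal_limits P N a"
  shows "alpha0 P N = (\<Sum>m\<in>{- int N..int N}. sqrt (a m * a (- m)))"
  unfolding alpha0_eq
proof (rule sum.cong[OF refl])
  fix m assume "m \<in> {- int N..int N}"
  then have "(\<lambda>i. ereal (diag m i)) \<longlonglongrightarrow> ereal (sqrt (a m * a (- m)))"
    using diag_limit[OF assms] by simp
  from lim_imp_Limsup[OF _ this]
  show "real_of_ereal (limsup (\<lambda>i. ereal (diag m i))) = sqrt (a m * a (- m))" by simp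
qed

lemma diagonal_limits_sum:
  assumes "diagonal_limits P N a"
  shows "(\<Sum>m\<in>{- int N..int N}. a m) = 1"
proof -
  have "(\<lambda>i. \<Sum>m\<in>{- int N..int N}. pmf (P i) (nat (int i + m))) \<longlonglongrightarrow> (\<Sum>m\<in>{- int N..int N}. a m)"
    using assms by (intro tendsto_intros) (auto simp: diagonal_limits_def)
  moreover have "eventually (\<lambda>i. (\<Sum>m\<in>{- int N..int N}. pmf (P i) (nat (int i + m))) = 1) sequentially"
    using eventually_ge_at_top[of "max i0 N"]
  proof eventually_elim
    case (elim i)
    have "(\<Sum>j\<in>{i - N..i + N}. pmf (P i) j) = 1"
      using elim far_row[of i] by (intro sum_pmf_eq_1) (auto simp: set_pmf_iff intro: ccontr)
    then show ?case using elim sum_diagonals[of N i "pmf (P i)"] by simp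
  qed
  then have "(\<lambda>i. \<Sum>m\<in>{- int N..int N}. pmf (P i) (nat (int i + m))) \<longlonglongrightarrow> 1"
    by (rule tendsto_eventually)
  ultimately show ?thesis by (rule LIMSEQ_unique)
qed

text \<open>
  The diagonals \<open>m\<close> and \<open>-m\<close> contribute \<open>2 sqrt (a m * a (-m))\<close> to \<open>\<alpha>\<^sub>0\<close> and \<open>a m + a (-m)\<close> to the
  total mass \<open>1\<close>; the difference is a square.
\<close>

lemma alpha0_formula:
  assumes a: "diagonal_limits P N a"
  shows "alpha0 P N = 1 - (\<Sum>m\<in>{1..int N}. (sqrt (a m) - sqrt (a (- m)))\<^sup>2)"
proof -
  have nn: "a m \<ge> 0" "a (- m) \<ge> 0" if "m \<in> {1..int N}" for m
    using that diagonal_limitsD(1)[OF a] by auto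
  have "(\<Sum>m\<in>{1..int N}. (sqrt (a m) - sqrt (a (- m)))\<^sup>2)
      = (\<Sum>m\<in>{1..int N}. (a m + a (- m)) - (sqrt (a m * a (- m)) + sqrt (a (- m) * a m)))"
    using nn by (intro sum.cong refl) (simp add: power2_diff real_sqrt_mult)
  also have "\<dots> = (\<Sum>m\<in>{1..int N}. a m + a (- m))
      - (\<Sum>m\<in>{1..int N}. sqrt (a m * a (- m)) + sqrt (a (- m) * a m))"
    by (rule sum_subtractf)
  also have "\<dots> = (1 - a 0) - (alpha0 P N - a 0)"
    using diagonal_limits_sum[OF a] alpha0_limit[OF a] diagonal_limitsD(1)[OF a, of 0]
    by (simp add: sum_symmetric_interval)
  finally show ?thesis by simp
qed

lemma alpha0_less_1:
  assumes a: "diagonal_limits P N a" and m: "m \<in> {1..int N}" "a m \<noteq> a (- m)"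
  shows "alpha0 P N < 1"
proof -
  have "0 < (sqrt (a m) - sqrt (a (- m)))\<^sup>2" using m by simp
  also have "\<dots> \<le> (\<Sum>m\<in>{1..int N}. (sqrt (a m) - sqrt (a (- m)))\<^sup>2)"
    using m by (intro member_le_sum) auto
  finally show ?thesis using alpha0_formula[OF a] by simp
qed

lemma tail_ratio_power:
  assumes "tail_ratio \<pi> \<tau>"
  shows "(\<lambda>i. pmf \<pi> (i + k) / pmf \<pi> i) \<longlonglongrightarrow> \<tau> ^ k"
proof (induction k)
  case 0
  then show ?case using pos by (simp add: less_imp_neq[THEN not_sym])
next
  case (Suc k)
  have "(\<lambda>i. pmf \<pi> (i + 1) / pmf \<pi> i) \<longlonglongrightarrow> \<tau>" using assms by (simp add: tail_ratio_def)
  from LIMSEQ_ignore_initial_segment[OF this, of k] Suc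
  have "(\<lambda>i. (pmf \<pi> (i + k + 1) / pmf \<pi> (i + k)) * (pmf \<pi> (i + k) / pmf \<pi> i)) \<longlonglongrightarrow> \<tau> * \<tau> ^ k"
    by (rule tendsto_mult)
  moreover have "pmf \<pi> j \<noteq> 0" for j using pos[of j] by simp
  ultimately show ?case by simp
qed

lemma diagonal_limits_reversible:
  assumes a: "diagonal_limits P N a" and \<tau>: "tail_ratio \<pi> \<tau>" and m: "m \<in> {1..int N}"
  shows "a m = \<tau> ^ nat m * a (- m)"
proof -
  have "(\<lambda>i. pmf (P i) (nat (int i + m))) \<longlonglongrightarrow> a m"
    using a m by (auto simp: diagonal_limits_def)
  moreover have "(\<lambda>i. pmf \<pi> (i + nat m) / pmf \<pi> i * pmf (P (nat (int i + m))) i) \<longlonglongrightarrow> \<tau> ^ nat m * a (- m)"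
    using m by (intro tendsto_mult tail_ratio_power \<tau> diagonal_backwards a) auto
  moreover have "pmf \<pi> (i + nat m) / pmf \<pi> i * pmf (P (nat (int i + m))) i = pmf (P i) (nat (int i + m))" for i
  proof -
    have "nat (int i + m) = i + nat m" using m by auto
    then show ?thesis using reversible[of i "i + nat m"] pos[of i] by (simp add: field_simps)
  qed
  ultimately show ?thesis by (simp add: LIMSEQ_unique)
qed

text \<open>
  The ratio test; summability of \<open>sqrt \<pi>\<close> is what makes the mean continuous on \<open>B\<^sub>V\<close>.
\<close>

lemma summable_sqrt_of_tail_ratio:
  assumes "tail_ratio \<pi> \<tau>"
  shows "summable (\<lambda>i. sqrt (pmf \<pi> i))"
proof -
  have \<tau>: "0 \<le> \<tau>" "\<tau> < 1" and lim: "(\<lambda>i. pmf \<pi> (i + 1) / pmf \<pi> i) \<longlonglongrightarrow> \<tau>"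
    using assms by (auto simp: tail_ratio_def)
  obtain c where c: "sqrt \<tau> < c" "c < 1" using dense[of "sqrt \<tau>" 1] \<tau> by auto
  have "(\<lambda>i. sqrt (pmf \<pi> (i + 1) / pmf \<pi> i)) \<longlonglongrightarrow> sqrt \<tau>" by (intro tendsto_intros lim)
  then have "eventually (\<lambda>i. sqrt (pmf \<pi> (i + 1) / pmf \<pi> i) < c) sequentially"
    using c by (intro order_tendstoD)
  then obtain n where n: "\<And>i. i \<ge> n \<Longrightarrow> sqrt (pmf \<pi> (i + 1) / pmf \<pi> i) < c"
    by (auto simp: eventually_sequentially)
  show ?thesis
  proof (rule summable_ratio_test[OF c(2), of n])
    fix i assume "i \<ge> n"
    then have "sqrt (pmf \<pi> (i + 1)) / sqrt (pmf \<pi> i) \<le> c"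
      using n[of i] by (simp add: real_sqrt_divide)
    then show "norm (sqrt (pmf \<pi> (Suc i))) \<le> c * norm (sqrt (pmf \<pi> i))"
      using pos[of i] by (simp add: divide_le_eq)
  qed
qed

end

theorem corollary1:
  fixes P :: "nat \<Rightarrow> nat pmf" and \<pi> :: "nat pmf" and i0 N :: nat
  assumes "irreducible_kernel P" and "aperiodic_kernel P"
    and "invariant_pmf P \<pi>" and "\<And>\<mu>. invariant_pmf P \<mu> \<Longrightarrow> \<mu> = \<pi>"
    and "N \<ge> 1"
    and "\<And>i j. i \<ge> i0 \<Longrightarrow> \<bar>int i - int j\<bar> > int N \<Longrightarrow> pmf (P i) j = 0"
    and "reversible_kernel P \<pi>"
  shows
    "(alpha0 P N < 1 \<longrightarrow>
        spectral_gap_l2 P \<pi> \<and> bounded_l2 P \<pi> \<and> r_ess_l2 P \<pi> \<le> alpha0 P N) \<and>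
     (\<forall>a. diagonal_limits P N a \<longrightarrow>
        alpha0 P N = 1 - (\<Sum>m\<in>{1..int N}. (sqrt (a m) - sqrt (a (- m)))\<^sup>2) \<and>
        ((\<exists>m\<in>{1..int N}. a m \<noteq> a (- m)) \<longrightarrow> alpha0 P N < 1)) \<and>
     (\<forall>a \<tau>. diagonal_limits P N a \<and> tail_ratio \<pi> \<tau> \<and> \<tau> \<in> {0<..<1} \<longrightarrow>
        (\<forall>m. 1 \<le> \<bar>m\<bar> \<and> \<bar>m\<bar> \<le> int N \<longrightarrow> a m \<noteq> 0 \<longrightarrow> a m \<noteq> a (- m)) \<and>
        ((\<exists>m. \<bar>m\<bar> \<in> {1..int N} \<and> a m \<noteq> 0) \<longrightarrow>
           gap_conclusions P \<pi> N \<and>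
           alpha0 P N = 1 - (\<Sum>m\<in>{1..int N}. (sqrt (a m) - sqrt (a (- m)))\<^sup>2))) \<and>
     (\<forall>a \<tau>. diagonal_limits P N a \<and> a 0 < 1 \<and> tail_ratio \<pi> \<tau> \<and> \<tau> = 0 \<longrightarrow>
        gap_conclusions P \<pi> N \<and> alpha0 P N = a 0)"
proof -
  interpret asymptotically_banded_kernel P \<pi> "i0 + N" i0 N
  proof
    fix i j
    show pos: "pmf \<pi> k > 0" for k using pos_invariant assms(1,3) .
    show "pmf \<pi> i * pmf (P i) j = pmf \<pi> j * pmf (P j) i"
      using assms(7) by (simp add: reversible_kernel_def)
    show "pmf (P i) j = 0" if "i + (i0 + N) < j"
      \<comment> \<open>a row below \<open>i0\<close> is controlled through the transposed entry, whose row index \<open>j\<close> exceeds \<open>i0\<close>\<close>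
    proof (cases "i \<ge> i0")
      case True
      then show ?thesis using that by (intro assms(6)) auto
    next
      case False
      then have "pmf (P j) i = 0" using that by (intro assms(6)) auto
      then show ?thesis
        using assms(7) pos[of i] unfolding reversible_kernel_def by (metis less_irrefl mult_eq_0_iff)
    qed
    show "pmf (P i) j = 0" if "i \<ge> i0" "\<bar>int i - int j\<bar> > int N"
      using that by (rule assms(6))
  qed
  have part1: "spectral_gap_l2 P \<pi> \<and> bounded_l2 P \<pi> \<and> r_ess_l2 P \<pi> \<le> alpha0 P N"
    if \<alpha>: "alpha0 P N < 1"
  proof (intro conjI bounded_l2)
    obtain r K where "tail_bound K r" "r < 1"
      using dense[OF \<alpha>] tail_bound_above_alpha0 by blast
    then show "spectral_gap_l2 P \<pi>" by (intro spectral_gap_l2_ex assms(1,2))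
    show "r_ess_l2 P \<pi> \<le> alpha0 P N"
      using tail_bound_above_alpha0 r_ess_l2_le by (meson dense_ge)
  qed
  have conclusions: "gap_conclusions P \<pi> N" if "tail_ratio \<pi> \<tau>" "alpha0 P N < 1" for \<tau>
    using that
    by (intro gap_conclusionsI assms(1,2) summable_sqrt_of_tail_ratio tail_bound_above_alpha0)
  have asymmetric: "a m \<noteq> a (- m)"
    if a: "diagonal_limits P N a" and \<tau>: "tail_ratio \<pi> \<tau>" "\<tau> \<in> {0<..<1}"
      and m: "1 \<le> \<bar>m\<bar>" "\<bar>m\<bar> \<le> int N" "a m \<noteq> 0" for a \<tau> m
  proof
    assume eq: "a m = a (- m)"
    have "a \<bar>m\<bar> = \<tau> ^ nat \<bar>m\<bar> * a (- \<bar>m\<bar>)"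
      using m by (intro diagonal_limits_reversible a \<tau>) auto
    then have "\<tau> ^ nat \<bar>m\<bar> = 1" using eq m(3) by (cases "m \<ge> 0") auto
    moreover have "\<tau> ^ nat \<bar>m\<bar> < 1" using \<tau>(2) m(1) by (intro power_less_one_iff[THEN iffD2]) auto
    ultimately show False by simp
  qed
  have part3: "alpha0 P N < 1"
    if a: "diagonal_limits P N a" and \<tau>: "tail_ratio \<pi> \<tau>" "\<tau> \<in> {0<..<1}"
      and m: "\<bar>m\<bar> \<in> {1..int N}" "a m \<noteq> 0" for a \<tau> m
  proof (rule alpha0_less_1[OF a m(1)])
    show "a \<bar>m\<bar> \<noteq> a (- \<bar>m\<bar>)" using asymmetric[OF a \<tau>, of m] m by (cases "m \<ge> 0") auto
  qed
  have part4: "alpha0 P N = a 0" if a: "diagonal_limits P N a" and \<tau>: "tail_ratio \<pi> 0" for a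
  proof -
    have "a m = 0" if "m \<in> {1..int N}" for m
      using diagonal_limits_reversible[OF a \<tau> that] that by (simp add: power_0_left)
    then show ?thesis
      using alpha0_limit[OF a] diagonal_limitsD(1)[OF a, of 0] by (simp add: sum_symmetric_interval)
  qed
  show ?thesis
  proof (intro conjI allI impI)
    fix a \<tau>
    assume "diagonal_limits P N a \<and> a 0 < 1 \<and> tail_ratio \<pi> \<tau> \<and> \<tau> = 0"
    then show "gap_conclusions P \<pi> N" "alpha0 P N = a 0"
      using part4[of a] conclusions[of \<tau>] by auto
  next
    fix a :: "int \<Rightarrow> real" and \<tau>
    assume a: "diagonal_limits P N a \<and> tail_ratio \<pi> \<tau> \<and> \<tau> \<in> {0<..<1}"
    show "a m \<noteq> a (- m)" if "1 \<le> \<bar>m\<bar> \<and> \<bar>m\<bar> \<le> int N" "a m \<noteq> 0" for m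
      using asymmetric[of a \<tau> m] a that by blast
    show "gap_conclusions P \<pi> N" if "\<exists>m. \<bar>m\<bar> \<in> {1..int N} \<and> a m \<noteq> 0"
      using part3[of a \<tau>] conclusions[of \<tau>] a that by blast
  qed (use part1 alpha0_formula alpha0_less_1 in blast)+
qed

end
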